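(* Let $d=1$, $0<\alpha<\frac14$, $\Omega=(-1,1)$, and $p_1=\frac{2(1-2\alpha)}{1-4\alpha}$. Let $K\subset\subset\Omega$ be a compact set and $2\le p\le\infty$. Then there is a constant $C$, independent of $\lambda$ and $e_\lambda$ (it may depend on $\alpha$, $K$ and $p$), such that for every $\lambda>1$ and every Dirichlet eigenfunction $e_\lambda$ of $(-\Delta)^{\alpha/2}$ on $\Omega$ with eigenvalue $\lambda$: $$\|e_\lambda\|_{L^p(K)}\le C\,\|e_\lambda\|_{L^2(\mathbb{R})}\quad\text{if } 2\le p\le p_1;$$ moreover, if $\frac18\le\alpha<\frac14$, $$\|e_\lambda\|_{L^p(K)}\le C\,\lambda^{\frac{1-4\alpha}{2\alpha}(1-\frac{p_1}{p})}\,\|e_\lambda\|_{L^2(\mathbb{R})}\quad\text{for } p_1<p\le\infty,$$ and if $0<\alpha<\frac18$, $$\|e_\lambda\|_{L^p(K)}\le C\,\lambda^{\frac{1-2\alpha}{3\alpha}(1-\frac{p_1}{p})}\,\|e_\lambda\|_{L^2(\mathbb{R})}\quad\text{for } p_1<p\le\infty.$$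
   Context: For $0<\alpha<2$, $(-\Delta)^{\alpha/2}$ denotes the Fourier multiplier on $\mathbb{R}$ with symbol $|\xi|^\alpha$; pointwise, $(-\Delta)^{\alpha/2}u(x)=c_{1,\alpha}\,\mathrm{p.v.}\int_{\mathbb{R}}\frac{u(x)-u(y)}{|x-y|^{1+\alpha}}\,dy$ with $c_{1,\alpha}=\frac{2^\alpha\Gamma(\frac{1+\alpha}{2})}{\pi^{1/2}|\Gamma(-\frac{\alpha}{2})|}$. A Dirichlet eigenfunction of $(-\Delta)^{\alpha/2}$ on $\Omega$ with eigenvalue $\lambda$ (restricted fractional Laplacian) is a function $e_\lambda\in H^{\alpha/2}(\mathbb{R})$ with $(-\Delta)^{\alpha/2}e_\lambda=\lambda e_\lambda$ in $\Omega$ and $e_\lambda=0$ in $\mathbb{R}\setminus\Omega$. The convention $p_1/\infty=0$ is used. *)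

theory Defs
  imports "HOL-Probability.Probability"
begin

definition Lp_norm :: "ennreal \<Rightarrow> 'a measure \<Rightarrow> ('a \<Rightarrow> 'b::real_normed_vector) \<Rightarrow> ennreal" where
  "Lp_norm p M f =
     (if p = \<infinity> then esssup M (\<lambda>x. ennreal (norm (f x)))
      else let I = (\<integral>\<^sup>+x. ennreal (norm (f x) powr enn2real p) \<partial>M)
           in if I = \<infinity> then \<infinity> else ennreal (enn2real I powr (1 / enn2real p)))"

definition L2_fun :: "(real \<Rightarrow> complex) \<Rightarrow> bool" where
  "L2_fun u \<longleftrightarrow> u \<in> borel_measurable lebesgue \<and> Lp_norm 2 lebesgue u < \<infinity>"

(* Convention: no factor in the forward transform, 1 / (2 pi) in the inverse transform,
   so that the second derivative has symbol - xi^2. *)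
definition fourier_integral :: "(real \<Rightarrow> complex) \<Rightarrow> real \<Rightarrow> complex" where
  "fourier_integral f \<xi> = (LINT x|lebesgue. f x * cis (- (x * \<xi>)))"

(* The Fourier-Plancherel transform: L^2 limit of the Fourier integrals over [-n, n].
   U is determined up to null sets. *)
definition has_L2_fourier :: "(real \<Rightarrow> complex) \<Rightarrow> (real \<Rightarrow> complex) \<Rightarrow> bool" where
  "has_L2_fourier u U \<longleftrightarrow> L2_fun u \<and> L2_fun U \<and>
     (\<lambda>n. Lp_norm 2 lebesgue
            (\<lambda>\<xi>. fourier_integral (\<lambda>x. indicator {- real n..real n} x * u x) \<xi> - U \<xi>))
       \<longlonglongrightarrow> 0"

definition L2_fourier :: "(real \<Rightarrow> complex) \<Rightarrow> real \<Rightarrow> complex" where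
  "L2_fourier u = (SOME U. has_L2_fourier u U)"

(* The space H^s(R) for s \<ge> 0. *)
definition sobolev :: "real \<Rightarrow> (real \<Rightarrow> complex) \<Rightarrow> bool" where
  "sobolev s u \<longleftrightarrow>
     (\<exists>U. has_L2_fourier u U \<and>
          (\<integral>\<^sup>+\<xi>. ennreal ((1 + \<xi>\<^sup>2) powr s * (cmod (U \<xi>))\<^sup>2) \<partial>lebesgue) < \<infinity>)"

definition smooth_fun :: "(real \<Rightarrow> complex) \<Rightarrow> bool" where
  "smooth_fun \<phi> \<longleftrightarrow>
     (\<exists>D :: nat \<Rightarrow> real \<Rightarrow> complex. D 0 = \<phi> \<and>
        (\<forall>k x. (D k has_vector_derivative D (Suc k) x) (at x)))"

definition test_fun :: "real set \<Rightarrow> (real \<Rightarrow> complex) \<Rightarrow> bool" where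
  "test_fun \<Omega> \<phi> \<longleftrightarrow> smooth_fun \<phi> \<and>
     compact (closure {x. \<phi> x \<noteq> 0}) \<and> closure {x. \<phi> x \<noteq> 0} \<subseteq> \<Omega>"

(* The Fourier multiplier with symbol m maps u to the distribution T whose Fourier transform is
   m U, where U is the Fourier transform of u. It is given here by its (bilinear) pairing with a
   test function: T(\<phi>) = 1 / (2 pi) * \<integral> m U \<phi>^(- \<xi>) d\<xi>, which is the integral of T \<phi> by
   Fourier inversion. *)
definition fourier_multiplier ::
    "(real \<Rightarrow> complex) \<Rightarrow> (real \<Rightarrow> complex) \<Rightarrow> (real \<Rightarrow> complex) \<Rightarrow> complex" where
  "fourier_multiplier m u \<phi> =
     (LINT \<xi>|lebesgue. m \<xi> * L2_fourier u \<xi> * fourier_integral \<phi> (- \<xi>)) / of_real (2 * pi)"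

(* The operator (- Laplacian)^(alpha / 2). *)
definition frac_laplacian :: "real \<Rightarrow> (real \<Rightarrow> complex) \<Rightarrow> (real \<Rightarrow> complex) \<Rightarrow> complex" where
  "frac_laplacian \<alpha> = fourier_multiplier (\<lambda>\<xi>. of_real (\<bar>\<xi>\<bar> powr \<alpha>))"

(* For u in H^(alpha/2) the operator only yields an element of H^(- alpha/2), so the equation
   in \<Omega> is an equality of distributions on \<Omega>; the exterior condition is that of an
   equivalence class. *)
definition dirichlet_eigenfunction ::
    "real \<Rightarrow> real set \<Rightarrow> real \<Rightarrow> (real \<Rightarrow> complex) \<Rightarrow> bool" where
  "dirichlet_eigenfunction \<alpha> \<Omega> l u \<longleftrightarrow>
     sobolev (\<alpha> / 2) u \<and>
     (\<forall>\<phi>. test_fun \<Omega> \<phi> \<longrightarrow>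
        frac_laplacian \<alpha> u \<phi> = of_real l * (LINT x|lebesgue. u x * \<phi> x)) \<and>
     (AE x in lebesgue. x \<notin> \<Omega> \<longrightarrow> u x = 0)"

end

theory Submission
  imports Defs
begin

text \<open>
  All three bounds come from a single one: on a compact subset \<open>K\<close> of \<open>{-1<..<1}\<close> an eigenfunction
  \<open>u\<close> satisfies \<open>\<bar>u\<bar> \<le> C \<parallel>u\<parallel>\<close> almost everywhere, where \<open>\<parallel>u\<parallel>\<close> is the \<open>L\<^sup>2\<close> norm and \<open>C\<close> does not
  depend on the eigenvalue (\<open>dirichlet_eigenfunction_interior_bound\<close>). Since \<open>K\<close> has finite measure,
  this bounds every \<open>L\<^sup>p\<close> norm on \<open>K\<close>, and the powers of \<open>l > 1\<close> on the right-hand sides have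
  nonnegative exponents.

  For the uniform bound, write the eigenvalue as \<open>\<mu> powr \<alpha>\<close>, let \<open>\<theta>\<close> be a smooth cut-off supported
  in \<open>{-1<..<1}\<close> and bounded below on \<open>K\<close>, and let \<open>V\<close> be the Fourier transform of \<open>\<theta> u\<close>. Multiplying
  the equation by \<open>\<theta>\<close> shows that \<open>(\<bar>\<xi>\<bar> powr \<alpha> - \<mu> powr \<alpha>) V\<close> is the Fourier transform of the commutator
  of the operator with \<open>\<theta>\<close>, applied to \<open>u\<close>. This commutator has order \<open>\<alpha> - 1\<close>: the elementary inequality
  \<open>\<bar>\<xi>\<bar> powr (1 - \<alpha>) * \<bar>\<bar>\<xi>\<bar> powr \<alpha> - \<bar>\<eta>\<bar> powr \<alpha>\<bar> \<le> \<bar>\<xi> - \<eta>\<bar>\<close> (\<open>powr_symbol_difference\<close>) together with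
  Young's and Bessel's inequalities shows that \<open>V\<close> and \<open>\<bar>\<xi>\<bar> powr (1 - \<alpha>) (\<bar>\<xi>\<bar> powr \<alpha> - \<mu> powr \<alpha>) V\<close> both
  have \<open>L\<^sup>2\<close> norms at most a constant times \<open>\<parallel>u\<parallel>\<close>. On the other hand, by concavity of the power function,
  \<open>\<bar>\<xi>\<bar> powr (1 - \<alpha>) * \<bar>\<bar>\<xi>\<bar> powr \<alpha> - \<mu> powr \<alpha>\<bar>\<close> grows linearly away from \<open>0\<close> and \<open>\<plusminus>\<mu>\<close>
  (\<open>powr_symbol_gap\<close>, \<open>resolvent_weight\<close>): the gain of \<open>1 - \<alpha>\<close> derivatives compensates exactly for the
  flatness of the symbol at high frequency. In dimension one a linearly growing weight has a square
  integrable reciprocal, so the Cauchy-Schwarz inequality bounds the \<open>L\<^sup>1\<close> norm of \<open>V\<close> by a constant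
  times \<open>\<parallel>u\<parallel>\<close>, independently of \<open>\<mu>\<close> (\<open>localized_eigenfunction_fourier_L1\<close>), and Fourier inversion bounds
  \<open>\<theta> u\<close>.

  The equation is distributional, and the localised equation in Fourier space is read off directly by
  testing with \<open>\<theta>\<close> times a character. Fourier inversion and Bessel's inequality for integrable functions
  are obtained by Gaussian summation.
\<close>

section \<open>The Fourier transform of an integrable function\<close>

lemma borel_measurable_cis [measurable]: "cis \<in> borel_measurable borel"
  by (intro borel_measurable_continuous_onI continuous_intros)

lemma fourier_integral_lborel:
  assumes [measurable]: "f \<in> borel_measurable borel"
  shows "fourier_integral f \<xi> = (LINT x|lborel. f x * cis (- (x * \<xi>)))"
  unfolding fourier_integral_def by (rule integral_completion) measurable

lemma integrable_mult_cis [simp]: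
  fixes f :: "real \<Rightarrow> complex" and g :: "real \<Rightarrow> real"
  assumes f: "integrable lborel f" and [measurable]: "g \<in> borel_measurable borel"
  shows "integrable lborel (\<lambda>x. f x * cis (g x))"
proof -
  have [measurable]: "f \<in> borel_measurable lborel" using f by auto
  show ?thesis
    by (rule Bochner_Integration.integrable_bound[OF f]) (auto simp: norm_mult)
qed

lemma fourier_integral_measurable [measurable]:
  assumes [measurable]: "f \<in> borel_measurable borel"
  shows "fourier_integral f \<in> borel_measurable borel"
proof -
  have "fourier_integral f = (\<lambda>\<xi>. LINT x|lborel. f x * cis (- (x * \<xi>)))"
    using fourier_integral_lborel[OF assms] by auto
  then show ?thesis by simp
qed

lemma norm_fourier_integral_le:
  assumes "integrable lborel f"
  shows "norm (fourier_integral f \<xi>) \<le> (LINT x|lborel. norm (f x))"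
proof -
  have [measurable]: "f \<in> borel_measurable borel" using assms by auto
  have "norm (fourier_integral f \<xi>) \<le> (LINT x|lborel. norm (f x * cis (- (x * \<xi>))))"
    unfolding fourier_integral_lborel[OF \<open>f \<in> borel_measurable borel\<close>] by (rule integral_norm_bound)
  then show ?thesis by (simp add: norm_mult)
qed

text \<open>
  The Fourier transform of a Gaussian is known from the characteristic function of the
  standard normal distribution. The normalisation is chosen so that the right-hand side is
  an approximate identity as \<open>\<epsilon>\<close> tends to 0.
\<close>

lemma fourier_gaussian:
  fixes \<epsilon> y :: real
  assumes "0 < \<epsilon>"
  shows "integrable lborel (\<lambda>\<xi>. of_real (exp (- (\<epsilon> * \<xi>)\<^sup>2 / 2)) * cis (y * \<xi>))" (is ?i)
    and "(LINT \<xi>|lborel. of_real (exp (- (\<epsilon> * \<xi>)\<^sup>2 / 2)) * cis (y * \<xi>))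
       = of_real (2 * pi * normal_density 0 \<epsilon> y)"
proof -
  have std: "integrable lborel (\<lambda>z. of_real (std_normal_density z) :: complex)"
    by (intro integrable_of_real) auto
  have "integrable lborel (\<lambda>\<xi>. sqrt (2 * pi) *\<^sub>R (of_real (std_normal_density (0 + \<epsilon> * \<xi>)) :: complex))"
    using assms by (intro integrable_scaleR_right lborel_integrable_real_affine[OF std]) auto
  also have "(\<lambda>\<xi>. sqrt (2 * pi) *\<^sub>R (of_real (std_normal_density (0 + \<epsilon> * \<xi>)) :: complex))
      = (\<lambda>\<xi>. of_real (exp (- (\<epsilon> * \<xi>)\<^sup>2 / 2)))"
  proof
    fix \<xi> :: real
    have "sqrt (2 * pi) * std_normal_density (0 + \<epsilon> * \<xi>) = exp (- (\<epsilon> * \<xi>)\<^sup>2 / 2)"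
      by (simp add: std_normal_density_def)
    then show "sqrt (2 * pi) *\<^sub>R (of_real (std_normal_density (0 + \<epsilon> * \<xi>)) :: complex)
      = of_real (exp (- (\<epsilon> * \<xi>)\<^sup>2 / 2))"
      by (simp only: scaleR_conv_of_real flip: of_real_mult)
  qed
  finally show i: ?i by simp
  have "of_real (exp (- (y / \<epsilon>)\<^sup>2 / 2)) = char std_normal_distribution (y / \<epsilon>)"
    by (simp add: char_std_normal_distribution)
  also have "\<dots> = (LINT z|lborel. std_normal_density z *\<^sub>R iexp (y / \<epsilon> * z))"
    unfolding char_def by (subst integral_density) auto
  also have "\<dots> = \<epsilon> *\<^sub>R (LINT \<xi>|lborel. std_normal_density (0 + \<epsilon> * \<xi>) *\<^sub>R iexp (y / \<epsilon> * (0 + \<epsilon> * \<xi>)))"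
    using assms by (subst lborel_integral_real_affine[where c=\<epsilon> and t=0]) auto
  also have "\<dots> = \<epsilon> *\<^sub>R (LINT \<xi>|lborel. (1 / sqrt (2 * pi)) *\<^sub>R (of_real (exp (- (\<epsilon> * \<xi>)\<^sup>2 / 2)) * cis (y * \<xi>)))"
    using assms by (intro arg_cong[where f="\<lambda>x. \<epsilon> *\<^sub>R x"] Bochner_Integration.integral_cong)
      (auto simp: std_normal_density_def cis_conv_exp scaleR_conv_of_real)
  also have "\<dots> = of_real (\<epsilon> / sqrt (2 * pi)) * (LINT \<xi>|lborel. of_real (exp (- (\<epsilon> * \<xi>)\<^sup>2 / 2)) * cis (y * \<xi>))"
    by (subst Bochner_Integration.integral_scaleR_right) (auto simp: scaleR_conv_of_real)
  finally have *: "of_real (exp (- (y / \<epsilon>)\<^sup>2 / 2)) =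
    of_real (\<epsilon> / sqrt (2 * pi)) * (LINT \<xi>|lborel. of_real (exp (- (\<epsilon> * \<xi>)\<^sup>2 / 2)) * cis (y * \<xi>))" .
  have "of_real (2 * pi * normal_density 0 \<epsilon> y)
      = of_real (sqrt (2 * pi) / \<epsilon>) * (of_real (exp (- (y / \<epsilon>)\<^sup>2 / 2)) :: complex)"
  proof -
    define c where "c = sqrt (2 * pi)"
    have c: "c > 0" "2 * pi = c * c" by (simp_all add: c_def)
    have "sqrt (2 * pi * \<epsilon>\<^sup>2) = c * \<epsilon>" using assms by (simp add: c_def real_sqrt_mult)
    then have "2 * pi * normal_density 0 \<epsilon> y = c * c * (1 / (c * \<epsilon>) * exp (- y\<^sup>2 / (2 * \<epsilon>\<^sup>2)))"
      using c(2) by (simp add: normal_density_def)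
    also have "\<dots> = c / \<epsilon> * exp (- (y / \<epsilon>)\<^sup>2 / 2)"
      using c(1) by (simp add: power_divide mult.commute)
    finally have "2 * pi * normal_density 0 \<epsilon> y = sqrt (2 * pi) / \<epsilon> * exp (- (y / \<epsilon>)\<^sup>2 / 2)"
      by (simp only: c_def)
    then show ?thesis by (simp only: flip: of_real_mult)
  qed
  also have "\<dots> = (LINT \<xi>|lborel. of_real (exp (- (\<epsilon> * \<xi>)\<^sup>2 / 2)) * cis (y * \<xi>))"
    unfolding * using assms by (simp add: field_simps flip: of_real_mult mult.assoc)
  finally show "(LINT \<xi>|lborel. of_real (exp (- (\<epsilon> * \<xi>)\<^sup>2 / 2)) * cis (y * \<xi>))
       = of_real (2 * pi * normal_density 0 \<epsilon> y)" by simp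
qed

lemma integrable_pair_mult:
  fixes f g :: "real \<Rightarrow> complex"
  assumes f: "integrable lborel f" and g: "integrable lborel g"
  shows "integrable (lborel \<Otimes>\<^sub>M lborel) (\<lambda>(x, y). f x * g y)"
proof (rule lborel_pair.Fubini_integrable)
  have [measurable]: "f \<in> borel_measurable borel" "g \<in> borel_measurable borel" using f g by auto
  show "(\<lambda>(x, y). f x * g y) \<in> borel_measurable (lborel \<Otimes>\<^sub>M lborel)" by measurable
  show "AE x in lborel. integrable lborel (\<lambda>y. (case (x, y) of (x, y) \<Rightarrow> f x * g y))"
    using g by simp
  show "integrable lborel (\<lambda>x. LINT y|lborel. norm (case (x, y) of (x, y) \<Rightarrow> f x * g y))"
    using f g by (simp add: norm_mult)
qed

text \<open>
  The kernels that occur below (characters, Gaussians) are bounded, so integrability of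
  the two factors alone justifies the interchange of integrals.
\<close>

lemma Fubini_mult_bounded:
  fixes f g :: "real \<Rightarrow> complex" and k :: "real \<times> real \<Rightarrow> complex"
  assumes f: "integrable lborel f" and g: "integrable lborel g"
    and [measurable]: "k \<in> borel_measurable borel" and k: "\<And>z. norm (k z) \<le> B"
  shows "(LINT x|lborel. f x * (LINT y|lborel. g y * k (x, y))) = (LINT y|lborel. g y * (LINT x|lborel. f x * k (x, y)))"
proof -
  have [measurable]: "f \<in> borel_measurable borel" "g \<in> borel_measurable borel" using f g by auto
  have [measurable]: "k \<in> borel_measurable (borel \<Otimes>\<^sub>M borel)" by (simp add: borel_prod)
  have "integrable (lborel \<Otimes>\<^sub>M lborel) (\<lambda>(x, y). f x * g y * k (x, y))"
  proof (rule Bochner_Integration.integrable_bound)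
    show "integrable (lborel \<Otimes>\<^sub>M lborel) (\<lambda>z. of_real B * (case z of (x, y) \<Rightarrow> f x * g y))"
      by (intro integrable_mult_right integrable_pair_mult f g)
    show "(\<lambda>(x, y). f x * g y * k (x, y)) \<in> borel_measurable (lborel \<Otimes>\<^sub>M lborel)" by measurable
    show "AE z in lborel \<Otimes>\<^sub>M lborel. norm (case z of (x, y) \<Rightarrow> f x * g y * k (x, y))
        \<le> norm (of_real B * (case z of (x, y) \<Rightarrow> f x * g y))"
    proof (rule AE_I2)
      fix z :: "real \<times> real"
      have "norm (k z) \<le> \<bar>B\<bar>" using k[of z] by linarith
      then show "norm (case z of (x, y) \<Rightarrow> f x * g y * k (x, y))
        \<le> norm (of_real B * (case z of (x, y) \<Rightarrow> f x * g y))"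
        by (cases z) (auto simp: norm_mult mult.commute[of "norm (f _) * norm (g _)"] intro!: mult_right_mono)
    qed
  qed
  from lborel_pair.Fubini_integral[OF this]
  have "(LINT y|lborel. LINT x|lborel. f x * g y * k (x, y)) = (LINT x|lborel. LINT y|lborel. f x * g y * k (x, y))" .
  moreover have "(LINT x|lborel. f x * g y * k (x, y)) = g y * (LINT x|lborel. f x * k (x, y))" for y
    by (subst integral_mult_right_zero[symmetric]) (simp add: ac_simps)
  moreover have "(LINT y|lborel. f x * g y * k (x, y)) = f x * (LINT y|lborel. g y * k (x, y))" for x
    by (subst integral_mult_right_zero[symmetric]) (simp add: ac_simps)
  ultimately show ?thesis by simp
qed

definition gauss_smooth :: "real \<Rightarrow> (real \<Rightarrow> complex) \<Rightarrow> real \<Rightarrow> complex" where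
  "gauss_smooth \<epsilon> f x = (LINT y|lborel. f y * of_real (normal_density 0 \<epsilon> (x - y)))"

lemma normal_density_le_inverse: "0 < \<epsilon> \<Longrightarrow> normal_density 0 \<epsilon> x \<le> 1 / \<epsilon>"
proof -
  assume e: "0 < \<epsilon>"
  have "1 \<le> sqrt (2 * pi)" using pi_ge_two by (simp add: real_le_rsqrt)
  then have "\<epsilon> \<le> sqrt (2 * pi * \<epsilon>\<^sup>2)" using e by (simp add: real_sqrt_mult)
  then have "1 / sqrt (2 * pi * \<epsilon>\<^sup>2) * exp (-(x - 0)\<^sup>2/ (2 * \<epsilon>\<^sup>2)) \<le> 1 / \<epsilon> * 1"
    using e by (intro mult_mono) (auto simp: frac_le)
  then show ?thesis by (simp add: normal_density_def)
qed

text \<open>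
  Damping the inverse Fourier integral by a Gaussian makes Fubini applicable, and turns the
  inversion formula into a convolution with an approximate identity. Both inversion and
  Bessel's inequality are limits of this formula.
\<close>

lemma gauss_smooth_eq_fourier:
  assumes f: "integrable lborel f" and "0 < \<epsilon>"
  shows "(LINT \<xi>|lborel. of_real (exp (- (\<epsilon> * \<xi>)\<^sup>2 / 2)) * (fourier_integral f \<xi> * cis (x * \<xi>)))
     = of_real (2 * pi) * gauss_smooth \<epsilon> f x"
proof -
  have [measurable]: "f \<in> borel_measurable borel" using f by auto
  define k :: "real \<times> real \<Rightarrow> complex" where "k = (\<lambda>(\<xi>, y). cis (x * \<xi> - y * \<xi>))"
  have "(LINT \<xi>|lborel. of_real (exp (- (\<epsilon> * \<xi>)\<^sup>2 / 2)) * (fourier_integral f \<xi> * cis (x * \<xi>)))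
    = (LINT \<xi>|lborel. of_real (exp (- (\<epsilon> * \<xi>)\<^sup>2 / 2)) * (LINT y|lborel. f y * k (\<xi>, y)))"
  proof (intro Bochner_Integration.integral_cong refl arg_cong2[where f="(*)"])
    fix \<xi> :: real
    show "fourier_integral f \<xi> * cis (x * \<xi>) = (LINT y|lborel. f y * k (\<xi>, y))"
      by (simp add: fourier_integral_lborel k_def cis_mult mult.assoc flip: integral_mult_left_zero)
  qed
  also have "\<dots> = (LINT y|lborel. f y * (LINT \<xi>|lborel. of_real (exp (- (\<epsilon> * \<xi>)\<^sup>2 / 2)) * k (\<xi>, y)))"
  proof (rule Fubini_mult_bounded[where B=1])
    show "integrable lborel (\<lambda>\<xi>. of_real (exp (- (\<epsilon> * \<xi>)\<^sup>2 / 2)) :: complex)"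
      using fourier_gaussian(1)[OF \<open>0 < \<epsilon>\<close>, of 0] by simp
    show "k \<in> borel_measurable borel"
      unfolding k_def borel_prod[symmetric] by measurable
  qed (auto simp: k_def f)
  also have "\<dots> = (LINT y|lborel. of_real (2 * pi) * (f y * of_real (normal_density 0 \<epsilon> (x - y))))"
  proof -
    have "(LINT \<xi>|lborel. of_real (exp (- (\<epsilon> * \<xi>)\<^sup>2 / 2)) * k (\<xi>, y)) = of_real (2 * pi * normal_density 0 \<epsilon> (x - y))" for y
      using fourier_gaussian(2)[OF \<open>0 < \<epsilon>\<close>, of "x - y"] by (simp add: k_def left_diff_distrib)
    then show ?thesis by (simp add: ac_simps)
  qed
  finally show ?thesis by (simp add: gauss_smooth_def)
qed

section \<open>Fourier inversion and Bessel's inequality\<close>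

text \<open>
  Open intervals generate the Borel sets and are stable under intersection, so the integrals
  over all bounded Borel sets vanish as well. Cutting off to \<open>{-N<..<N}\<close> provides the
  integrability that countable additivity needs.
\<close>

lemma AE_eq_0_if_interval_integrals_eq_0:
  fixes h :: "real \<Rightarrow> complex"
  assumes [measurable]: "h \<in> borel_measurable borel"
    and int: "\<And>a b. integrable lborel (\<lambda>x. indicator {a<..<b} x *\<^sub>R h x)"
    and zero: "\<And>a b. (LINT x|lborel. indicator {a<..<b} x *\<^sub>R h x) = 0"
  shows "AE x in lborel. h x = 0"
proof -
  have "AE x in lborel. indicator {- real N<..<real N} x *\<^sub>R h x = 0" for N :: nat
  proof -
    define g where "g x = indicator {- real N<..<real N} x *\<^sub>R h x" for x
    have g: "integrable lborel g" and g0: "integral\<^sup>L lborel g = 0"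
      unfolding g_def by (fact int, fact zero)
    have "AE x in lborel. g x = 0"
    proof (rule sigma_finite_measure.density_zero[OF sigma_finite_lborel g])
      fix A :: "real set" assume "A \<in> sets lborel"
      let ?G = "range (\<lambda>(a, b). {a<..<b::real})"
      have borel_Ioo: "borel = sigma UNIV ?G"
        using borel_eq_box[where 'a=real] by simp
      have "Int_stable ?G"
      proof (rule Int_stableI)
        fix A B :: "real set" assume "A \<in> ?G" "B \<in> ?G"
        then obtain a b c d where "A = {a<..<b}" "B = {c<..<d}" by auto
        then have "A \<inter> B = (\<lambda>(a, b). {a<..<b}) (max a c, min b d)" by auto
        then show "A \<inter> B \<in> ?G" by blast
      qed
      moreover have "A \<in> sigma_sets UNIV ?G"
        using \<open>A \<in> sets lborel\<close> unfolding sets_lborel borel_Ioo by simp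
      ultimately show "set_lebesgue_integral lborel A g = 0"
      proof (induction rule: sigma_sets_induct_disjoint[OF _ subset_UNIV[of ?G, folded Pow_UNIV], consumes 2, case_names basic empty compl union])
        case (basic A)
        then obtain a b where A: "A = {a<..<b}" by auto
        have "set_lebesgue_integral lborel A g
           = (LINT x|lborel. indicator {max a (- real N)<..<min b (real N)} x *\<^sub>R h x)"
          unfolding set_lebesgue_integral_def A g_def
          by (intro Bochner_Integration.integral_cong) (auto simp: indicator_def)
        then show ?case by (simp add: zero)
      next
        case empty
        then show ?case by (simp add: set_lebesgue_integral_def)
      next
        case (compl A)
        then have A: "A \<in> sets borel" unfolding borel_Ioo by simp
        have "set_lebesgue_integral lborel (UNIV - A) g = (LINT x|lborel. g x - indicator A x *\<^sub>R g x)"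
          unfolding set_lebesgue_integral_def
          by (intro Bochner_Integration.integral_cong) (auto simp: indicator_def)
        also have "\<dots> = 0"
          using compl A g g0 unfolding set_lebesgue_integral_def
          by (subst Bochner_Integration.integral_diff) (auto intro: integrable_mult_indicator)
        finally show ?case .
      next
        case (union A)
        then have A: "A i \<in> sets lborel" for i unfolding sets_lborel borel_Ioo by auto
        then have "set_integrable lborel (\<Union>i. A i) g"
          unfolding set_integrable_def using g by (intro integrable_mult_indicator) auto
        with A union(1) have "set_lebesgue_integral lborel (\<Union>i. A i) g = (\<Sum>i. set_lebesgue_integral lborel (A i) g)"
          by (intro lebesgue_integral_countable_add) (auto simp: disjoint_family_on_def)
        then show ?case using union by simp
      qed
    qed
    then show ?thesis by (simp add: g_def)
  qed
  then have "AE x in lborel. \<forall>N::nat. indicator {- real N<..<real N} x *\<^sub>R h x = 0"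
    by (subst AE_all_countable) blast
  then show ?thesis
  proof eventually_elim
    case (elim x)
    obtain N :: nat where "\<bar>x\<bar> < real N" using reals_Archimedean2 by blast
    with elim[rule_format, of N] show ?case by (auto simp: indicator_def)
  qed
qed

lemma integrable_indicator_Ioo: "integrable lborel (indicator {a<..<b::real} :: real \<Rightarrow> real)"
  by (intro integrable_real_indicator emeasure_bounded_finite) auto

lemma inverse_Suc_mult_tendsto_0: "(\<lambda>n. inverse (real (Suc n)) * z) \<longlonglongrightarrow> 0"
  using tendsto_mult_left_zero[OF LIMSEQ_inverse_real_of_nat] .

text \<open>
  Smoothing converges weakly against indicators of intervals: by symmetry of the Gaussian it
  may be moved to the indicator, where the smoothed value at \<open>y\<close> is the probability that
  \<open>y + \<epsilon> Z\<close> lies in the interval, for a standard normal \<open>Z\<close>. This tends to the indicator away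
  from the two end points.
\<close>

lemma gauss_smooth_interval_tendsto:
  assumes f: "integrable lborel f"
  shows "(\<lambda>n. LINT x|lborel. indicator {a<..<b} x * gauss_smooth (inverse (real (Suc n))) f x)
    \<longlonglongrightarrow> (LINT x|lborel. indicator {a<..<b} x * f x)"
proof -
  have [measurable]: "f \<in> borel_measurable borel" using f by auto
  let ?I = "indicator {a<..<b} :: real \<Rightarrow> complex"
  define e where "e n = inverse (real (Suc n))" for n
  have e: "e n > 0" for n by (simp add: e_def)
  define m where "m n y = (LINT z|lborel. ?I (y + e n * z) * of_real (std_normal_density z))" for n y
  have \<gamma>: "integrable lborel (\<lambda>z. of_real (std_normal_density z) :: complex)"
    by (intro integrable_of_real) auto
  have mass: "(LINT x|lborel. ?I x * of_real (normal_density 0 (e n) (x - y))) = m n y" for n y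
  proof -
    have "(LINT x|lborel. ?I x * of_real (normal_density 0 (e n) (x - y)))
      = e n *\<^sub>R (LINT z|lborel. ?I (y + e n * z) * of_real (normal_density 0 (e n) (y + e n * z - y)))"
      using e[of n] by (subst lborel_integral_real_affine[where c="e n" and t=y]) auto
    also have "\<dots> = (LINT z|lborel. e n *\<^sub>R (?I (y + e n * z) * of_real (normal_density 0 (e n) (y + e n * z - y))))"
      by simp
    also have "\<dots> = m n y"
    proof -
      have "sqrt (2 * pi * (e n)\<^sup>2) = sqrt (2 * pi) * e n" using e[of n] by (simp add: real_sqrt_mult)
      then have "e n * normal_density 0 (e n) (y + e n * z - y) = std_normal_density z" for z
        using e[of n] by (simp add: normal_density_def power_mult_distrib)
      then have "e n *\<^sub>R (?I (y + e n * z) * of_real (normal_density 0 (e n) (y + e n * z - y)))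
        = ?I (y + e n * z) * of_real (std_normal_density z)" for z
        by (metis (no_types, lifting) mult.left_commute of_real_mult scaleR_conv_of_real)
      then show ?thesis unfolding m_def by simp
    qed
    finally show ?thesis .
  qed
  have swap: "(LINT x|lborel. ?I x * gauss_smooth (e n) f x) = (LINT y|lborel. f y * m n y)" for n
  proof -
    define k :: "real \<times> real \<Rightarrow> complex" where "k = (\<lambda>(x, y). of_real (normal_density 0 (e n) (x - y)))"
    have "(LINT x|lborel. ?I x * (LINT y|lborel. f y * k (x, y))) = (LINT y|lborel. f y * (LINT x|lborel. ?I x * k (x, y)))"
    proof (rule Fubini_mult_bounded[OF _ f, where B="1 / e n"])
      have "integrable lborel (\<lambda>x. of_real (indicator {a<..<b} x) :: complex)"
        by (intro integrable_of_real integrable_indicator_Ioo)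
      then show "integrable lborel ?I" by (simp add: of_real_indicator)
      show "k \<in> borel_measurable borel" unfolding k_def borel_prod[symmetric] by measurable
      show "norm (k z) \<le> 1 / e n" for z using normal_density_le_inverse[OF e[of n]] by (cases z) (auto simp: k_def)
    qed
    then show ?thesis by (simp add: k_def gauss_smooth_def mass)
  qed
  have mi: "integrable lborel (\<lambda>z. ?I (y + e n * z) * of_real (std_normal_density z))" for n y
    by (rule Bochner_Integration.integrable_bound[OF \<gamma>]) (auto simp: norm_mult split: split_indicator)
  have m_le: "norm (m n y) \<le> 1" for n y
  proof -
    have "norm (m n y) \<le> (LINT z|lborel. std_normal_density z)"
      unfolding m_def by (rule Bochner_Integration.integral_norm_bound_integral[OF mi])
        (auto simp: norm_mult split: split_indicator)
    then show ?thesis by simp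
  qed
  have m_lim: "(\<lambda>n. m n y) \<longlonglongrightarrow> ?I y" if y: "y \<noteq> a" "y \<noteq> b" for y
  proof -
    have "(\<lambda>n. m n y) \<longlonglongrightarrow> (LINT z|lborel. ?I y * of_real (std_normal_density z))"
      unfolding m_def
    proof (rule integral_dominated_convergence[where w=std_normal_density])
      show "AE z in lborel. (\<lambda>n. ?I (y + e n * z) * of_real (std_normal_density z))
          \<longlonglongrightarrow> ?I y * of_real (std_normal_density z)"
      proof (intro AE_I2 tendsto_mult tendsto_const)
        fix z
        have lim: "(\<lambda>n. y + e n * z) \<longlonglongrightarrow> y"
          using tendsto_add[OF tendsto_const[of y] inverse_Suc_mult_tendsto_0[of z]] by (simp add: e_def)
        have "eventually (\<lambda>n. ?I (y + e n * z) = ?I y) sequentially"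
        proof (cases "y \<in> {a<..<b}")
          case True
          then have "eventually (\<lambda>n. y + e n * z \<in> {a<..<b}) sequentially"
            by (intro topological_tendstoD[OF lim]) auto
          then show ?thesis by eventually_elim (use True in \<open>auto simp: indicator_def\<close>)
        next
          case False
          with y have "y \<in> - {a..b}" by auto
          then have "eventually (\<lambda>n. y + e n * z \<in> - {a..b}) sequentially"
            by (intro topological_tendstoD[OF lim]) (auto intro: open_Compl)
          then show ?thesis by eventually_elim (use False in \<open>auto simp: indicator_def\<close>)
        qed
        then show "(\<lambda>n. ?I (y + e n * z)) \<longlonglongrightarrow> ?I y"
          by (rule tendsto_eventually)
      qed
    qed (auto simp: norm_mult split: split_indicator)
    then show ?thesis by simp
  qed
  have [measurable]: "m n \<in> borel_measurable borel" for n
    unfolding m_def by measurable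
  have "(\<lambda>n. LINT y|lborel. f y * m n y) \<longlonglongrightarrow> (LINT y|lborel. f y * ?I y)"
  proof (rule integral_dominated_convergence[where w="\<lambda>y. norm (f y)"])
    have "AE y in lborel. y \<noteq> a" "AE y in lborel. y \<noteq> b" by (auto intro: AE_lborel_singleton)
    then show "AE y in lborel. (\<lambda>n. f y * m n y) \<longlonglongrightarrow> f y * ?I y"
      by eventually_elim (intro tendsto_mult tendsto_const m_lim)
    show "AE y in lborel. norm (f y * m n y) \<le> norm (f y)" for n
      using m_le[of n] by (auto simp: norm_mult intro!: AE_I2 mult_left_le)
  qed (use f in auto)
  then show ?thesis unfolding swap[unfolded e_def] by (simp add: ac_simps)
qed

text \<open>
  The Gaussian smoothings of \<open>f\<close> converge pointwise and boundedly to the inverse Fourier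
  integral, because the Fourier transform is integrable; they converge to \<open>f\<close> weakly. Hence
  \<open>f\<close> and the inverse Fourier integral have the same integral over every bounded interval.
\<close>

theorem fourier_inversion_AE:
  assumes f: "integrable lborel f" and F: "integrable lborel (fourier_integral f)"
  shows "AE x in lborel. f x = (LINT \<xi>|lborel. fourier_integral f \<xi> * cis (x * \<xi>)) / of_real (2 * pi)"
proof -
  have [measurable]: "f \<in> borel_measurable borel" using f by auto
  define w where "w x = (LINT \<xi>|lborel. fourier_integral f \<xi> * cis (x * \<xi>)) / of_real (2 * pi)" for x
  have [measurable]: "w \<in> borel_measurable borel" unfolding w_def by measurable
  define e where "e n = inverse (real (Suc n))" for n
  have e: "e n > 0" for n by (simp add: e_def)
  define G where "G n \<xi> = (of_real (exp (- (e n * \<xi>)\<^sup>2 / 2)) :: complex)" for n \<xi>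
  have G: "norm (G n \<xi>) \<le> 1" for n \<xi> unfolding G_def by (simp add: norm_of_real)
  have [measurable]: "G n \<in> borel_measurable borel" for n unfolding G_def by measurable
  have sm: "gauss_smooth (e n) f x = (LINT \<xi>|lborel. G n \<xi> * (fourier_integral f \<xi> * cis (x * \<xi>))) / of_real (2 * pi)" for n x
    using gauss_smooth_eq_fourier[OF f e[of n], of x] by (simp add: G_def)
  define M where "M = (LINT \<xi>|lborel. norm (fourier_integral f \<xi>)) / (2 * pi)"
  have iG: "integrable lborel (\<lambda>\<xi>. G n \<xi> * (fourier_integral f \<xi> * cis (x * \<xi>)))" for n x
    by (rule Bochner_Integration.integrable_bound[OF F])
      (use G[of n] in \<open>auto simp: norm_mult intro!: mult_left_le_one_le\<close>)
  have sm_le: "norm (gauss_smooth (e n) f x) \<le> M" for n x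
  proof -
    have "norm (LINT \<xi>|lborel. G n \<xi> * (fourier_integral f \<xi> * cis (x * \<xi>))) \<le> (LINT \<xi>|lborel. norm (fourier_integral f \<xi>))"
      by (rule Bochner_Integration.integral_norm_bound_integral[OF iG])
        (use F G[of n] in \<open>auto simp: norm_mult intro!: mult_left_le_one_le\<close>)
    then show ?thesis unfolding sm M_def by (simp add: norm_divide divide_right_mono)
  qed
  have sm_lim: "(\<lambda>n. gauss_smooth (e n) f x) \<longlonglongrightarrow> w x" for x
  proof -
    have "(\<lambda>n. LINT \<xi>|lborel. G n \<xi> * (fourier_integral f \<xi> * cis (x * \<xi>)))
      \<longlonglongrightarrow> (LINT \<xi>|lborel. 1 * (fourier_integral f \<xi> * cis (x * \<xi>)))"
    proof (rule integral_dominated_convergence[where w="\<lambda>\<xi>. norm (fourier_integral f \<xi>)"])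
      show "AE \<xi> in lborel. (\<lambda>n. G n \<xi> * (fourier_integral f \<xi> * cis (x * \<xi>))) \<longlonglongrightarrow> 1 * (fourier_integral f \<xi> * cis (x * \<xi>))"
      proof (intro AE_I2 tendsto_mult tendsto_const)
        fix \<xi>
        have "(\<lambda>n. of_real (exp (- (e n * \<xi>)\<^sup>2 / 2)) :: complex) \<longlonglongrightarrow> of_real (exp (- 0\<^sup>2 / 2))"
          unfolding e_def by (intro tendsto_intros inverse_Suc_mult_tendsto_0) auto
        then show "(\<lambda>n. G n \<xi>) \<longlonglongrightarrow> 1" by (simp add: G_def)
      qed
    qed (use F G in \<open>auto simp: norm_mult intro!: mult_left_le_one_le\<close>)
    then show ?thesis unfolding sm w_def by (intro tendsto_divide) auto
  qed
  have w_le: "norm (w x) \<le> M" for x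
    by (rule LIMSEQ_le_const2[OF tendsto_norm[OF sm_lim[of x]]]) (use sm_le in auto)
  have ind: "integrable lborel (\<lambda>x. indicator {a<..<b} x * M)" for a b :: real
    by (intro integrable_mult_left integrable_indicator_Ioo)
  have iw: "integrable lborel (\<lambda>x. indicator {a<..<b} x * w x)" for a b :: real
    by (rule Bochner_Integration.integrable_bound[OF ind[of a b]])
      (use order_trans[OF w_le abs_ge_self] in \<open>auto simp: norm_mult split: split_indicator\<close>)
  have int_f: "integrable lborel (\<lambda>x. indicator {a<..<b} x * f x)" for a b :: real
    by (rule Bochner_Integration.integrable_bound[OF f]) (auto simp: norm_mult split: split_indicator)
  have "(LINT x|lborel. indicator {a<..<b} x * f x) = (LINT x|lborel. indicator {a<..<b} x * w x)" for a b
  proof (rule LIMSEQ_unique[OF gauss_smooth_interval_tendsto[OF f]])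
    show "(\<lambda>n. LINT x|lborel. indicator {a<..<b} x * gauss_smooth (inverse (real (Suc n))) f x)
      \<longlonglongrightarrow> (LINT x|lborel. indicator {a<..<b} x * w x)"
    proof (rule integral_dominated_convergence[OF _ _ ind[of a b]])
      have "gauss_smooth (inverse (real (Suc n))) f \<in> borel_measurable borel" for n
        unfolding gauss_smooth_def by measurable
      then show "(\<lambda>x. indicator {a<..<b} x * gauss_smooth (inverse (real (Suc n))) f x) \<in> borel_measurable lborel" for n
        by measurable
      show "AE x in lborel. (\<lambda>n. indicator {a<..<b} x * gauss_smooth (inverse (real (Suc n))) f x) \<longlonglongrightarrow> indicator {a<..<b} x * w x"
        using sm_lim unfolding e_def by (auto intro!: tendsto_mult)
      show "AE x in lborel. norm (indicator {a<..<b} x * gauss_smooth (inverse (real (Suc n))) f x) \<le> indicator {a<..<b} x * M" for n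
        using sm_le unfolding e_def by (auto split: split_indicator)
    qed measurable
  qed
  moreover have "indicator {a<..<b} x *\<^sub>R (f x - w x) = indicator {a<..<b} x * f x - indicator {a<..<b} x * w x" for a b x :: real
    by (auto simp: indicator_def)
  ultimately have "integrable lborel (\<lambda>x. indicator {a<..<b} x *\<^sub>R (f x - w x))"
    and "(LINT x|lborel. indicator {a<..<b} x *\<^sub>R (f x - w x)) = 0" for a b
    using int_f[of a b] iw[of a b] by simp_all
  then have "AE x in lborel. f x - w x = 0"
    by (intro AE_eq_0_if_interval_integrals_eq_0) auto
  then show ?thesis unfolding w_def by simp
qed

lemma borel_measurable_cnj [measurable]: "cnj \<in> borel_measurable borel"
  by (intro borel_measurable_continuous_onI continuous_intros)

lemma norm_integral_le_nn_integral:
  fixes f :: "'a \<Rightarrow> 'b::{banach, second_countable_topology}"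
  shows "ennreal (norm (integral\<^sup>L M f)) \<le> (\<integral>\<^sup>+x. ennreal (norm (f x)) \<partial>M)"
  using integral_norm_bound_ennreal[of M f] by (cases "integrable M f") (auto simp: not_integrable_integral_eq)

lemma nn_integral_normal_density_reflect: "0 < \<epsilon> \<Longrightarrow> (\<integral>\<^sup>+y. ennreal (normal_density 0 \<epsilon> (x - y)) \<partial>lborel) = 1"
proof -
  assume "0 < \<epsilon>"
  interpret prob_space "density lborel (normal_density 0 \<epsilon>)"
    by (rule prob_space_normal_density) fact
  have "1 = (\<integral>\<^sup>+y. ennreal (normal_density 0 \<epsilon> y) \<partial>lborel)"
    using emeasure_space_1 by (simp add: emeasure_density)
  also have "\<dots> = ennreal \<bar>- 1\<bar> * (\<integral>\<^sup>+y. ennreal (normal_density 0 \<epsilon> (x + (- 1) * y)) \<partial>lborel)"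
    by (rule nn_integral_real_affine) auto
  finally show ?thesis by simp
qed

text \<open>
  With a Gaussian damping, the left-hand side equals, up to the factor \<open>2\<pi>\<close>, the pairing of
  \<open>f\<close> with its own smoothing, which is at most the square of its \<open>L\<^sup>2\<close> norm because the kernel
  is symmetric and has mass 1. The damping is removed by Fatou's lemma.
\<close>

theorem bessel_fourier:
  assumes f: "integrable lborel f"
  shows "(\<integral>\<^sup>+\<xi>. ennreal ((norm (fourier_integral f \<xi>))\<^sup>2) \<partial>lborel)
     \<le> ennreal (2 * pi) * (\<integral>\<^sup>+x. ennreal ((norm (f x))\<^sup>2) \<partial>lborel)"
proof -
  have [measurable]: "f \<in> borel_measurable borel" using f by auto
  define F where "F = fourier_integral f"
  have [measurable]: "F \<in> borel_measurable borel" unfolding F_def by measurable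
  define e where "e n = inverse (real (Suc n))" for n
  have e: "e n > 0" for n by (simp add: e_def)
  define G where "G n \<xi> = exp (- (e n * \<xi>)\<^sup>2 / 2)" for n \<xi>
  have [measurable]: "G n \<in> borel_measurable borel" for n unfolding G_def by measurable
  have iG: "integrable lborel (\<lambda>\<xi>. of_real (G n \<xi>) :: complex)" for n
    using fourier_gaussian(1)[OF e[of n], of 0] by (simp add: G_def)
  define M where "M = (LINT x|lborel. norm (f x))"
  have FM: "norm (F \<xi>) \<le> M" for \<xi> unfolding F_def M_def by (rule norm_fourier_integral_le[OF f])
  have iGF: "integrable lborel (\<lambda>\<xi>. of_real (G n \<xi>) * F \<xi>)" for n
    by (rule Bochner_Integration.integrable_bound[OF integrable_mult_right[OF iG, of "of_real M" n]])
      (use order_trans[OF FM abs_ge_self] in \<open>auto simp: norm_mult mult.commute intro!: mult_right_mono\<close>)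
  define N2 where "N2 = (\<integral>\<^sup>+x. ennreal ((norm (f x))\<^sup>2) \<partial>lborel)"
  have damped: "(\<integral>\<^sup>+\<xi>. ennreal (G n \<xi> * (norm (F \<xi>))\<^sup>2) \<partial>lborel) \<le> ennreal (2 * pi) * N2" for n
  proof -
    define k :: "real \<times> real \<Rightarrow> complex" where "k = (\<lambda>(\<xi>, x). cis (x * \<xi>))"
    have cnj: "cnj (F \<xi>) = (LINT x|lborel. cnj (f x) * k (\<xi>, x))" for \<xi>
    proof -
      have "cnj (LINT x|lborel. f x * cis (- (x * \<xi>))) = (LINT x|lborel. cnj (f x * cis (- (x * \<xi>))))"
        by (rule Bochner_Integration.integral_cnj[symmetric])
      then show ?thesis by (simp add: F_def fourier_integral_lborel k_def cis_cnj)
    qed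
    have iGFF: "integrable lborel (\<lambda>\<xi>. (of_real (G n \<xi>) * F \<xi>) * cnj (F \<xi>))"
      by (rule Bochner_Integration.integrable_bound[OF integrable_mult_right[OF iGF, of "of_real M" n]])
        (use order_trans[OF FM abs_ge_self] in \<open>auto simp: norm_mult mult.commute intro!: mult_right_mono\<close>)
    have GFF: "(of_real (G n \<xi>) * F \<xi>) * cnj (F \<xi>) = of_real (G n \<xi> * (norm (F \<xi>))\<^sup>2)" for \<xi>
      by (simp only: mult.assoc complex_norm_square of_real_mult)
    have "(\<integral>\<^sup>+\<xi>. ennreal (G n \<xi> * (norm (F \<xi>))\<^sup>2) \<partial>lborel)
        = ennreal (LINT \<xi>|lborel. G n \<xi> * (norm (F \<xi>))\<^sup>2)"
      using integrable_Re[OF iGFF[unfolded GFF]] by (intro nn_integral_eq_integral) (auto simp: G_def)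
    also have "\<dots> = ennreal (norm (LINT \<xi>|lborel. (of_real (G n \<xi>) * F \<xi>) * cnj (F \<xi>)))"
      unfolding GFF integral_complex_of_real
      by (simp add: G_def del: of_real_mult)
    also have "(LINT \<xi>|lborel. (of_real (G n \<xi>) * F \<xi>) * cnj (F \<xi>))
       = (LINT x|lborel. cnj (f x) * (LINT \<xi>|lborel. (of_real (G n \<xi>) * F \<xi>) * k (\<xi>, x)))"
      unfolding cnj
    proof (rule Fubini_mult_bounded[OF iGF _, where B=1])
      show "integrable lborel (\<lambda>x. cnj (f x))" using f by simp
      show "k \<in> borel_measurable borel" unfolding k_def borel_prod[symmetric] by measurable
    qed (auto simp: k_def)
    also have "\<dots> = (LINT x|lborel. cnj (f x) * (of_real (2 * pi) * gauss_smooth (e n) f x))"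
      using gauss_smooth_eq_fourier[OF f e[of n]] by (simp add: k_def F_def G_def mult.assoc)
    also have "ennreal (norm \<dots>) \<le> (\<integral>\<^sup>+x. ennreal (norm (cnj (f x) * (of_real (2 * pi) * gauss_smooth (e n) f x))) \<partial>lborel)"
      by (rule norm_integral_le_nn_integral)
    also have "\<dots> \<le> (\<integral>\<^sup>+x. ennreal (2 * pi) * (\<integral>\<^sup>+y. ennreal (norm (f x) * norm (f y) * normal_density 0 (e n) (x - y)) \<partial>lborel) \<partial>lborel)"
    proof (rule nn_integral_mono)
      fix x
      have "ennreal (norm (cnj (f x) * (of_real (2 * pi) * gauss_smooth (e n) f x)))
        = ennreal (2 * pi) * (ennreal (norm (f x)) * ennreal (norm (gauss_smooth (e n) f x)))"
        by (simp add: norm_mult ennreal_mult ac_simps)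
      also have "ennreal (norm (gauss_smooth (e n) f x)) \<le> (\<integral>\<^sup>+y. ennreal (norm (f y) * normal_density 0 (e n) (x - y)) \<partial>lborel)"
        unfolding gauss_smooth_def by (rule order_trans[OF norm_integral_le_nn_integral]) (simp add: norm_mult)
      finally show "ennreal (norm (cnj (f x) * (of_real (2 * pi) * gauss_smooth (e n) f x)))
        \<le> ennreal (2 * pi) * (\<integral>\<^sup>+y. ennreal (norm (f x) * norm (f y) * normal_density 0 (e n) (x - y)) \<partial>lborel)"
        by (simp add: ennreal_mult' mult.assoc nn_integral_cmult mult_left_mono)
    qed
    also have "\<dots> = ennreal (2 * pi) * (\<integral>\<^sup>+x. (\<integral>\<^sup>+y. ennreal (norm (f x) * norm (f y) * normal_density 0 (e n) (x - y)) \<partial>lborel) \<partial>lborel)"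
      by (rule nn_integral_cmult) measurable
    also have "(\<integral>\<^sup>+x. (\<integral>\<^sup>+y. ennreal (norm (f x) * norm (f y) * normal_density 0 (e n) (x - y)) \<partial>lborel) \<partial>lborel)
       \<le> (\<integral>\<^sup>+x. (\<integral>\<^sup>+y. ennreal ((norm (f x))\<^sup>2 / 2 * normal_density 0 (e n) (x - y))
            + ennreal ((norm (f y))\<^sup>2 / 2 * normal_density 0 (e n) (x - y)) \<partial>lborel) \<partial>lborel)"
    proof (intro nn_integral_mono)
      fix x y
      have "norm (f x) * norm (f y) \<le> (norm (f x))\<^sup>2 / 2 + (norm (f y))\<^sup>2 / 2"
        using sum_squares_bound[of "norm (f x)" "norm (f y)"] by simp
      then have "norm (f x) * norm (f y) * normal_density 0 (e n) (x - y)
         \<le> (norm (f x))\<^sup>2 / 2 * normal_density 0 (e n) (x - y) + (norm (f y))\<^sup>2 / 2 * normal_density 0 (e n) (x - y)"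
        by (metis mult_right_mono normal_density_nonneg distrib_right)
      from ennreal_leI[OF this]
      show "ennreal (norm (f x) * norm (f y) * normal_density 0 (e n) (x - y))
        \<le> ennreal ((norm (f x))\<^sup>2 / 2 * normal_density 0 (e n) (x - y))
            + ennreal ((norm (f y))\<^sup>2 / 2 * normal_density 0 (e n) (x - y))"
        by (simp add: ennreal_plus)
    qed
    also have "\<dots> = (\<integral>\<^sup>+x. (\<integral>\<^sup>+y. ennreal ((norm (f x))\<^sup>2 / 2 * normal_density 0 (e n) (x - y)) \<partial>lborel) \<partial>lborel)
            + (\<integral>\<^sup>+x. (\<integral>\<^sup>+y. ennreal ((norm (f y))\<^sup>2 / 2 * normal_density 0 (e n) (x - y)) \<partial>lborel) \<partial>lborel)"
      by (simp add: nn_integral_add)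
    also have "(\<integral>\<^sup>+x. (\<integral>\<^sup>+y. ennreal ((norm (f y))\<^sup>2 / 2 * normal_density 0 (e n) (x - y)) \<partial>lborel) \<partial>lborel)
       = (\<integral>\<^sup>+y. (\<integral>\<^sup>+x. ennreal ((norm (f y))\<^sup>2 / 2 * normal_density 0 (e n) (y - x)) \<partial>lborel) \<partial>lborel)"
    proof (subst lborel_pair.Fubini')
      have "normal_density 0 (e n) (x - y) = normal_density 0 (e n) (y - x)" for x y
        by (simp add: normal_density_def power2_commute)
      then show "(\<integral>\<^sup>+y. (\<integral>\<^sup>+x. ennreal ((norm (f y))\<^sup>2 / 2 * normal_density 0 (e n) (x - y)) \<partial>lborel) \<partial>lborel) =
       (\<integral>\<^sup>+y. (\<integral>\<^sup>+x. ennreal ((norm (f y))\<^sup>2 / 2 * normal_density 0 (e n) (y - x)) \<partial>lborel) \<partial>lborel)" by simp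
    qed measurable
    also have "(\<integral>\<^sup>+x. (\<integral>\<^sup>+y. ennreal ((norm (f x))\<^sup>2 / 2 * normal_density 0 (e n) (x - y)) \<partial>lborel) \<partial>lborel)
        = (\<integral>\<^sup>+x. ennreal ((norm (f x))\<^sup>2 / 2) \<partial>lborel)"
    proof (rule nn_integral_cong)
      fix x
      have "(\<integral>\<^sup>+y. ennreal ((norm (f x))\<^sup>2 / 2) * ennreal (normal_density 0 (e n) (x - y)) \<partial>lborel)
        = ennreal ((norm (f x))\<^sup>2 / 2)"
        by (subst nn_integral_cmult) (auto simp: nn_integral_normal_density_reflect[OF e[of n]])
      then show "(\<integral>\<^sup>+y. ennreal ((norm (f x))\<^sup>2 / 2 * normal_density 0 (e n) (x - y)) \<partial>lborel)
        = ennreal ((norm (f x))\<^sup>2 / 2)"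
        by (subst ennreal_mult') auto
    qed
    also have "(\<integral>\<^sup>+x. ennreal ((norm (f x))\<^sup>2 / 2) \<partial>lborel) + (\<integral>\<^sup>+x. ennreal ((norm (f x))\<^sup>2 / 2) \<partial>lborel) = N2"
      unfolding N2_def by (subst nn_integral_add[symmetric]) (auto simp flip: ennreal_plus)
    finally show ?thesis by (simp add: mult_left_mono)
  qed
  have "(\<integral>\<^sup>+\<xi>. ennreal ((norm (F \<xi>))\<^sup>2) \<partial>lborel)
      = (\<integral>\<^sup>+\<xi>. liminf (\<lambda>n. ennreal (G n \<xi> * (norm (F \<xi>))\<^sup>2)) \<partial>lborel)"
  proof (rule nn_integral_cong)
    fix \<xi>
    have "(\<lambda>n. exp (- (e n * \<xi>)\<^sup>2 / 2)) \<longlonglongrightarrow> exp (- 0\<^sup>2 / 2)"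
      unfolding e_def by (intro tendsto_intros inverse_Suc_mult_tendsto_0) auto
    then have "(\<lambda>n. ennreal (G n \<xi> * (norm (F \<xi>))\<^sup>2)) \<longlonglongrightarrow> ennreal (1 * (norm (F \<xi>))\<^sup>2)"
      unfolding G_def by (intro tendsto_ennrealI tendsto_mult) auto
    then show "ennreal ((norm (F \<xi>))\<^sup>2) = liminf (\<lambda>n. ennreal (G n \<xi> * (norm (F \<xi>))\<^sup>2))"
      by (simp add: lim_imp_Liminf)
  qed
  also have "\<dots> \<le> liminf (\<lambda>n. \<integral>\<^sup>+\<xi>. ennreal (G n \<xi> * (norm (F \<xi>))\<^sup>2) \<partial>lborel)"
    by (rule nn_integral_liminf) measurable
  also have "\<dots> \<le> ennreal (2 * pi) * N2"
    by (rule Liminf_le[OF trivial_limit_sequentially]) (use damped in auto)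
  finally show ?thesis unfolding F_def N2_def .
qed

section \<open>Smooth cut-off functions\<close>

text \<open>
  The factors \<open>(1 / x) ^ n\<close> are included so that the family is closed under differentiation
  up to linear combinations.
\<close>

definition flat_exp :: "nat \<Rightarrow> real \<Rightarrow> real" where
  "flat_exp n x = (if 0 < x then (1 / x) ^ n * exp (- (1 / x)) else 0)"

lemma flat_exp_has_derivative:
  "(flat_exp n has_real_derivative (flat_exp (n + 2) x - real n * flat_exp (n + 1) x)) (at x)"
proof (cases x "0::real" rule: linorder_cases)
  case less
  have "((\<lambda>x. 0) has_real_derivative 0) (at x)" by simp
  then have "(flat_exp n has_real_derivative 0) (at x)"
    by (rule has_field_derivative_transform_within_open[of _ _ _ "{..<0}"])
      (use less in \<open>auto simp: flat_exp_def\<close>)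
  with less show ?thesis by (simp add: flat_exp_def)
next
  case greater
  have "((\<lambda>t. t ^ n * exp (- t)) has_real_derivative
      real n * t ^ (n - 1) * exp (- t) - t ^ n * exp (- t)) (at t)" for t :: real
    by (auto intro!: derivative_eq_intros simp: algebra_simps)
  moreover have "((\<lambda>x. 1 / x) has_real_derivative - (1 / x\<^sup>2)) (at x)"
    using greater by (auto intro!: derivative_eq_intros simp: power2_eq_square divide_simps)
  ultimately have D: "((\<lambda>x. (1 / x) ^ n * exp (- (1 / x))) has_real_derivative
      (real n * (1 / x) ^ (n - 1) * exp (- (1 / x)) - (1 / x) ^ n * exp (- (1 / x))) * - (1 / x\<^sup>2)) (at x)"
    by (rule DERIV_chain2)
  have p1: "real n * (1 / x) ^ (n - 1) * (1 / x\<^sup>2) = real n * (1 / x) ^ (n + 1)"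
    by (cases n) (auto simp: power2_eq_square field_simps)
  have p2: "(1 / x) ^ n * (1 / x\<^sup>2) = (1 / x) ^ (n + 2)"
    by (simp add: power_add power_one_over power2_eq_square)
  have "(real n * (1 / x) ^ (n - 1) * exp (- (1 / x)) - (1 / x) ^ n * exp (- (1 / x))) * - (1 / x\<^sup>2)
      = ((1 / x) ^ n * (1 / x\<^sup>2)) * exp (- (1 / x)) - (real n * (1 / x) ^ (n - 1) * (1 / x\<^sup>2)) * exp (- (1 / x))"
    by (simp only: algebra_simps)
  also have "\<dots> = flat_exp (n + 2) x - real n * flat_exp (n + 1) x"
    unfolding p1 p2 flat_exp_def using greater by (simp only: if_True mult.assoc)
  finally have "((\<lambda>x. (1 / x) ^ n * exp (- (1 / x))) has_real_derivative
      flat_exp (n + 2) x - real n * flat_exp (n + 1) x) (at x)"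
    using D by (simp only:)
  then show ?thesis
    by (rule has_field_derivative_transform_within_open[of _ _ _ "{0<..}"])
      (use greater in \<open>auto simp: flat_exp_def\<close>)
next
  case equal
  have "((\<lambda>h. flat_exp n h / h) \<longlongrightarrow> 0) (at 0)"
  proof (rule filterlim_split_at)
    have "eventually (\<lambda>h::real. 0 = flat_exp n h / h) (at_left 0)"
      by (auto simp: eventually_at_left_field flat_exp_def intro: exI[of _ "-1"])
    then show "((\<lambda>h. flat_exp n h / h) \<longlongrightarrow> 0) (at_left 0)"
      by (rule Lim_transform_eventually[OF tendsto_const])
    have "((\<lambda>h::real. inverse h ^ (n + 1) / exp (inverse h)) \<longlongrightarrow> 0) (at_right 0)"
      by (rule filterlim_compose[OF tendsto_power_div_exp_0 filterlim_inverse_at_top_right])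
    moreover have "eventually (\<lambda>h::real. inverse h ^ (n + 1) / exp (inverse h) = flat_exp n h / h) (at_right 0)"
      unfolding eventually_at_right_field
      by (intro exI[of _ 1]) (auto simp: flat_exp_def exp_minus field_simps)
    ultimately show "((\<lambda>h. flat_exp n h / h) \<longlongrightarrow> 0) (at_right 0)"
      by (rule Lim_transform_eventually)
  qed
  with equal show ?thesis by (simp add: DERIV_def) (simp add: flat_exp_def)
qed

text \<open>
  Smoothness is coinductive: iterating a choice of derivatives inside a class of functions
  closed under differentiation yields the required sequence of derivatives.
\<close>

lemma smooth_fun_coinduct:
  assumes "P f" and step: "\<And>f. P f \<Longrightarrow> \<exists>f'. P f' \<and> (\<forall>x. (f has_vector_derivative f' x) (at x))"
  shows "smooth_fun f"
proof -
  obtain d where d: "\<And>f. P f \<Longrightarrow> P (d f) \<and> (\<forall>x. (f has_vector_derivative d f x) (at x))"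
    using step by metis
  have P: "P ((d ^^ k) f)" for k
    by (induction k) (auto simp: \<open>P f\<close> d)
  show ?thesis
    unfolding smooth_fun_def
    by (rule exI[of _ "\<lambda>k. (d ^^ k) f"]) (use d[OF P] in auto)
qed

text \<open>
  An algebra that contains the cut-off functions and the characters by which they are modulated. It is
  closed under differentiation, which gives smoothness of all its members without a formula for
  higher derivatives.
\<close>

inductive bump_algebra :: "(real \<Rightarrow> complex) \<Rightarrow> bool" where
  const: "bump_algebra (\<lambda>x. c)"
| flat: "bump_algebra (\<lambda>x. of_real (flat_exp n (a + b * x)))"
| cis: "bump_algebra (\<lambda>x. cis (b * x))"
| add: "bump_algebra f \<Longrightarrow> bump_algebra g \<Longrightarrow> bump_algebra (\<lambda>x. f x + g x)"
| mult: "bump_algebra f \<Longrightarrow> bump_algebra g \<Longrightarrow> bump_algebra (\<lambda>x. f x * g x)"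

lemma bump_algebra_derivative:
  "bump_algebra f \<Longrightarrow> \<exists>f'. bump_algebra f' \<and> (\<forall>x. (f has_vector_derivative f' x) (at x))"
proof (induction rule: bump_algebra.induct)
  case (const c)
  show ?case by (intro exI[of _ "\<lambda>x. 0"] conjI bump_algebra.const) auto
next
  case (flat n a b)
  let ?f' = "\<lambda>x. of_real b * (of_real (flat_exp (n + 2) (a + b * x))
      + of_real (- real n) * of_real (flat_exp (n + 1) (a + b * x))) :: complex"
  have "bump_algebra ?f'" by (intro bump_algebra.intros)
  moreover have "((\<lambda>x. of_real (flat_exp n (a + b * x)) :: complex) has_vector_derivative ?f' x) (at x)" for x
  proof -
    have "((\<lambda>x. a + b * x) has_real_derivative b) (at x)" by (auto intro!: derivative_eq_intros)
    from DERIV_chain2[OF flat_exp_has_derivative this]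
    have "((\<lambda>x. flat_exp n (a + b * x)) has_real_derivative
      (flat_exp (n + 2) (a + b * x) - real n * flat_exp (n + 1) (a + b * x)) * b) (at x)" .
    from has_vector_derivative_of_real[OF this]
    show ?thesis by (simp add: mult.commute)
  qed
  ultimately show ?case by blast
next
  case (cis b)
  let ?f' = "\<lambda>x. (\<i> * of_real b) * cis (b * x)"
  have "bump_algebra ?f'" by (intro bump_algebra.intros)
  moreover have "((\<lambda>x. cis (b * x)) has_vector_derivative ?f' x) (at x)" for x
  proof -
    have "((\<lambda>x. exp (x *\<^sub>R (\<i> * of_real b))) has_vector_derivative (exp (x *\<^sub>R (\<i> * of_real b)) * (\<i> * of_real b))) (at x)"
      by (rule exp_scaleR_has_vector_derivative_right)
    then show ?thesis by (simp add: cis_conv_exp scaleR_conv_of_real ac_simps)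
  qed
  ultimately show ?case by blast
next
  case (add f g)
  then obtain f' g' where *: "bump_algebra f'" "bump_algebra g'"
    "\<And>x. (f has_vector_derivative f' x) (at x)" "\<And>x. (g has_vector_derivative g' x) (at x)" by blast
  then show ?case
    by (intro exI[of _ "\<lambda>x. f' x + g' x"]) (auto intro: bump_algebra.add has_vector_derivative_add)
next
  case (mult f g)
  then obtain f' g' where *: "bump_algebra f'" "bump_algebra g'"
    "\<And>x. (f has_vector_derivative f' x) (at x)" "\<And>x. (g has_vector_derivative g' x) (at x)" by blast
  show ?case
  proof (intro exI[of _ "\<lambda>x. f x * g' x + f' x * g x"] conjI allI)
    show "bump_algebra (\<lambda>x. f x * g' x + f' x * g x)" by (intro bump_algebra.intros * mult.hyps)
  qed (intro has_vector_derivative_mult *)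
qed

lemma bump_algebra_smooth: "bump_algebra f \<Longrightarrow> smooth_fun f"
  by (rule smooth_fun_coinduct[of bump_algebra]) (auto dest: bump_algebra_derivative)

text \<open>
  A cut-off supported in \<open>{-r..r}\<close>. It is not identically 1 on a smaller interval, which would
  require quotients or integrals of such functions; a positive lower bound there is enough.
  The affine arguments are written so that they match the generators of \<open>bump_algebra\<close>.
\<close>

definition bump :: "real \<Rightarrow> real \<Rightarrow> complex" where
  "bump r x = of_real (flat_exp 0 (r + (- 1) * x)) * of_real (flat_exp 0 (r + 1 * x))"

lemma bump_algebra_bump: "bump_algebra (bump r)"
  unfolding bump_def by (intro bump_algebra.intros)

lemma bump_eq_0: "r \<le> \<bar>x\<bar> \<Longrightarrow> bump r x = 0"
  by (auto simp: bump_def flat_exp_def abs_if split: if_splits)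

lemma norm_bump_ge:
  assumes "\<bar>x\<bar> \<le> s" "s < r"
  shows "(exp (- (1 / (r - s))))\<^sup>2 \<le> norm (bump r x)"
proof -
  have "exp (- (1 / (r - s))) \<le> flat_exp 0 y" if "r - s \<le> y" for y
    using assms that by (auto simp: flat_exp_def intro!: divide_left_mono mult_pos_pos)
  then have *: "exp (- (1 / (r - s))) \<le> \<bar>flat_exp 0 y\<bar>" if "r - s \<le> y" for y
    using that by (meson abs_ge_self order_trans)
  show ?thesis
    unfolding bump_def norm_mult power2_eq_square norm_of_real
    by (intro mult_mono *) (use assms in auto)
qed

lemma norm_bump_le: "norm (bump r x) \<le> 1"
proof -
  have "\<bar>flat_exp 0 y\<bar> \<le> 1" for y by (auto simp: flat_exp_def)
  then have "\<bar>flat_exp 0 (r + (- 1) * x)\<bar> * \<bar>flat_exp 0 (r + 1 * x)\<bar> \<le> 1 * 1"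
    by (intro mult_mono) auto
  then show ?thesis unfolding bump_def norm_mult norm_of_real by simp
qed

lemma test_fun_bump_cis:
  assumes "0 < r" "r < 1"
  shows "test_fun {-1<..<1} (\<lambda>x. bump r x * cis (b * x))"
proof -
  have "{x. bump r x * cis (b * x) \<noteq> 0} \<subseteq> {-r..r}"
  proof
    fix x assume "x \<in> {x. bump r x * cis (b * x) \<noteq> 0}"
    then have "\<not> r \<le> \<bar>x\<bar>" using bump_eq_0[of r x] by auto
    then show "x \<in> {-r..r}" by auto
  qed
  then have sub: "closure {x. bump r x * cis (b * x) \<noteq> 0} \<subseteq> {-r..r}"
    by (intro closure_minimal) auto
  then have "compact (closure {x. bump r x * cis (b * x) \<noteq> 0})"
    by (meson bounded_closed_interval bounded_subset closed_closure compact_eq_bounded_closed)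
  moreover have "smooth_fun (\<lambda>x. bump r x * cis (b * x))"
    by (intro bump_algebra_smooth bump_algebra.intros bump_algebra_bump)
  moreover have "closure {x. bump r x * cis (b * x) \<noteq> 0} \<subseteq> {-1<..<1}"
    using sub assms by force
  ultimately show ?thesis unfolding test_fun_def by blast
qed

lemma integrable_continuous_compact_support:
  fixes f :: "real \<Rightarrow> complex"
  assumes "continuous_on UNIV f" and "\<And>x. R < \<bar>x\<bar> \<Longrightarrow> f x = 0"
  shows "integrable lborel f"
proof -
  have "integrable lborel (\<lambda>x. indicator {-R..R} x *\<^sub>R f x)"
    by (rule borel_integrable_compact) (auto intro: continuous_on_subset[OF assms(1)])
  also have "(\<lambda>x. indicator {-R..R} x *\<^sub>R f x) = f"
  proof
    fix x
    show "indicator {-R..R} x *\<^sub>R f x = f x"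
    proof (cases "x \<in> {-R..R}")
      case False
      then have "R < \<bar>x\<bar>" by auto
      with False show ?thesis using assms(2) by simp
    qed simp
  qed
  finally show ?thesis .
qed

lemma continuous_bump: "continuous_on UNIV (bump r)"
proof -
  obtain f' where "\<And>x. (bump r has_vector_derivative f' x) (at x)"
    using bump_algebra_derivative[OF bump_algebra_bump[of r]] by blast
  then show ?thesis
    by (auto intro!: continuous_at_imp_continuous_on has_vector_derivative_continuous)
qed

lemma bump_measurable [measurable]: "bump r \<in> borel_measurable borel"
  by (rule borel_measurable_continuous_onI[OF continuous_bump])

lemma integrable_bump: "integrable lborel (bump r)"
proof (rule integrable_continuous_compact_support[OF continuous_bump])
  show "bump r x = 0" if "r < \<bar>x\<bar>" for x using that by (simp add: bump_eq_0)
qed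

lemma fourier_integral_derivative:
  assumes d: "\<And>x. (f has_vector_derivative f' x) (at x)"
    and cont: "continuous_on UNIV f'" and supp: "\<And>x. R < \<bar>x\<bar> \<Longrightarrow> f x = 0"
  shows "\<And>x. R < \<bar>x\<bar> \<Longrightarrow> f' x = 0"
    and "fourier_integral f' \<xi> = \<i> * of_real \<xi> * fourier_integral f \<xi>"
proof -
  show f'0: "f' x = 0" if x: "R < \<bar>x\<bar>" for x
  proof -
    have "open {x::real. R < \<bar>x\<bar>}" by (intro open_Collect_less continuous_intros)
    moreover have "((\<lambda>x. 0) has_vector_derivative 0) (at x)" by simp
    ultimately have "(f has_vector_derivative 0) (at x)"
      using x supp by (intro has_vector_derivative_transform_within_open[of "\<lambda>x. 0" 0 x "{x. R < \<bar>x\<bar>}" f]) auto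
    then show ?thesis using d vector_derivative_unique_at by blast
  qed
  have contf: "continuous_on UNIV f"
    using d by (auto intro!: continuous_at_imp_continuous_on has_vector_derivative_continuous)
  have f: "integrable lborel f" and f': "integrable lborel f'"
    using integrable_continuous_compact_support[OF contf supp]
      integrable_continuous_compact_support[OF cont f'0] by auto
  define h' where "h' x = f x * (cis (- (x * \<xi>)) * (- \<i> * of_real \<xi>)) + f' x * cis (- (x * \<xi>))" for x
  have h': "((\<lambda>x. f x * cis (- (x * \<xi>))) has_vector_derivative h' x) (at x)" for x
  proof -
    have "((\<lambda>x. exp (x *\<^sub>R (- \<i> * of_real \<xi>))) has_vector_derivative (exp (x *\<^sub>R (- \<i> * of_real \<xi>)) * (- \<i> * of_real \<xi>))) (at x)"
      by (rule exp_scaleR_has_vector_derivative_right)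
    then have "((\<lambda>x. cis (- (x * \<xi>))) has_vector_derivative (cis (- (x * \<xi>)) * (- \<i> * of_real \<xi>))) (at x)"
      by (simp add: cis_conv_exp scaleR_conv_of_real ac_simps)
    then show ?thesis unfolding h'_def by (intro has_vector_derivative_mult d)
  qed
  \<comment> \<open>Strictly beyond the support, so that the boundary terms vanish.\<close>
  define S where "S = \<bar>R\<bar> + 1"
  have "(LINT x|lborel. indicator {-S..S} x *\<^sub>R h' x) = f S * cis (- (S * \<xi>)) - f (-S) * cis (- ((-S) * \<xi>))"
  proof (rule integral_FTC_Icc)
    show "((\<lambda>x. f x * cis (- (x * \<xi>))) has_vector_derivative h' x) (at x within {-S..S})" for x
      by (rule has_vector_derivative_at_within[OF h'])
    show "continuous_on {-S..S} h'"
      unfolding h'_def by (intro continuous_intros continuous_on_subset[OF contf] continuous_on_subset[OF cont]) auto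
  qed (simp add: S_def)
  also have "\<dots> = 0" using supp[of S] supp[of "-S"] by (simp add: S_def)
  also have "(\<lambda>x. indicator {-S..S} x *\<^sub>R h' x) = h'"
  proof
    fix x
    show "indicator {-S..S} x *\<^sub>R h' x = h' x"
    proof (cases "x \<in> {-S..S}")
      case False
      then have "R < \<bar>x\<bar>" by (auto simp: S_def)
      with False show ?thesis using supp f'0 by (simp add: h'_def)
    qed simp
  qed
  finally have "0 = (LINT x|lborel. (- \<i> * of_real \<xi>) * (f x * cis (- (x * \<xi>))) + f' x * cis (- (x * \<xi>)))"
    unfolding h'_def by (simp add: ac_simps)
  also have "\<dots> = (- \<i> * of_real \<xi>) * (LINT x|lborel. f x * cis (- (x * \<xi>))) + (LINT x|lborel. f' x * cis (- (x * \<xi>)))"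
    using f f' by (subst Bochner_Integration.integral_add) auto
  finally show "fourier_integral f' \<xi> = \<i> * of_real \<xi> * fourier_integral f \<xi>"
    using f f' by (simp add: fourier_integral_lborel eq_neg_iff_add_eq_0 add.commute)
qed

lemma smooth_fourier_decay:
  assumes "smooth_fun f" and supp: "\<And>x. R < \<bar>x\<bar> \<Longrightarrow> f x = 0"
  shows "\<exists>C\<ge>0. \<forall>\<xi>. \<bar>\<xi>\<bar> ^ k * norm (fourier_integral f \<xi>) \<le> C"
proof -
  obtain D where D: "D 0 = f" "\<And>k x. (D k has_vector_derivative D (Suc k) x) (at x)"
    using assms(1) unfolding smooth_fun_def by blast
  have cont: "continuous_on UNIV (D k)" for k
    using D(2) by (auto intro!: continuous_at_imp_continuous_on has_vector_derivative_continuous)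
  have "(\<forall>x. R < \<bar>x\<bar> \<longrightarrow> D k x = 0) \<and> (\<forall>\<xi>. fourier_integral (D k) \<xi> = (\<i> * of_real \<xi>) ^ k * fourier_integral f \<xi>)" for k
  proof (induction k)
    case (Suc k)
    then show ?case
      using fourier_integral_derivative[OF D(2)[of k] cont[of "Suc k"], of R] by (auto simp: mult.assoc)
  qed (use D supp in auto)
  then have k: "\<And>x. R < \<bar>x\<bar> \<Longrightarrow> D k x = 0"
    and F: "\<And>\<xi>. norm (fourier_integral (D k) \<xi>) = \<bar>\<xi>\<bar> ^ k * norm (fourier_integral f \<xi>)"
    by (auto simp: norm_mult norm_power)
  have "integrable lborel (D k)"
    by (rule integrable_continuous_compact_support[OF cont k])
  from norm_fourier_integral_le[OF this] show ?thesis
    unfolding F by (intro exI[of _ "LINT x|lborel. norm (D k x)"]) auto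
qed

text \<open>
  Three derivatives give decay of order 3; one power of \<open>\<xi>\<close> is spent on the weight that the
  commutator estimate needs, and the remaining decay is integrable.
\<close>

lemma smooth_fourier_decay_quadratic:
  assumes "smooth_fun f" and "\<And>x. R < \<bar>x\<bar> \<Longrightarrow> f x = 0"
  shows "\<exists>C. \<forall>\<xi>. (1 + \<bar>\<xi>\<bar>) * norm (fourier_integral f \<xi>) \<le> C * inverse (1 + \<xi>\<^sup>2)"
proof -
  obtain A B where A: "\<And>\<xi>. norm (fourier_integral f \<xi>) \<le> A"
    and B: "\<And>\<xi>. \<bar>\<xi>\<bar> ^ 3 * norm (fourier_integral f \<xi>) \<le> B"
    using smooth_fourier_decay[of f R 0, OF assms] smooth_fourier_decay[of f R 3, OF assms] by auto
  have "(1 + \<bar>\<xi>\<bar>) * norm (fourier_integral f \<xi>) \<le> (3 * (A + B)) * inverse (1 + \<xi>\<^sup>2)" for \<xi>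
  proof -
    have "(1 + s) * (1 + s\<^sup>2) \<le> 3 * (1 + s ^ 3)" if "0 \<le> s" for s :: real
    proof -
      have "0 \<le> (1 - s)\<^sup>2 * (1 + s)" using that by simp
      moreover have "0 \<le> s ^ 3" using that by simp
      ultimately show ?thesis by (simp add: power2_eq_square power3_eq_cube algebra_simps)
    qed
    from mult_right_mono[OF this[of "\<bar>\<xi>\<bar>"], of "norm (fourier_integral f \<xi>)"]
    have "(1 + \<bar>\<xi>\<bar>) * (1 + \<xi>\<^sup>2) * norm (fourier_integral f \<xi>) \<le> 3 * (1 + \<bar>\<xi>\<bar> ^ 3) * norm (fourier_integral f \<xi>)"
      by simp
    also have "\<dots> \<le> 3 * (A + B)" using A[of \<xi>] B[of \<xi>] by (simp add: algebra_simps)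
    finally have "(1 + \<bar>\<xi>\<bar>) * norm (fourier_integral f \<xi>) * (1 + \<xi>\<^sup>2) \<le> 3 * (A + B)"
      by (simp add: ac_simps)
    moreover have "0 < 1 + \<xi>\<^sup>2" by (simp add: add_pos_nonneg)
    ultimately show ?thesis by (simp add: pos_le_divide_eq flip: divide_inverse)
  qed
  then show ?thesis by blast
qed

lemma integrable_inverse_1_plus_square_lborel: "integrable lborel (\<lambda>x::real. inverse (1 + x\<^sup>2))"
  using integrable_inverse_1_plus_square by (simp add: set_integrable_def)

section \<open>Estimates for the localised eigenvalue equation\<close>

lemma nn_integral_shift:
  fixes g :: "real \<Rightarrow> ennreal"
  assumes [measurable]: "g \<in> borel_measurable borel"
  shows "(\<integral>\<^sup>+x. g (x - c) \<partial>lborel) = (\<integral>\<^sup>+x. g x \<partial>lborel)"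
  using nn_integral_real_affine[of g 1 "- c"] by simp

lemma nn_integral_reflect:
  fixes g :: "real \<Rightarrow> ennreal"
  assumes [measurable]: "g \<in> borel_measurable borel"
  shows "(\<integral>\<^sup>+x. g (c - x) \<partial>lborel) = (\<integral>\<^sup>+x. g x \<partial>lborel)"
  using nn_integral_real_affine[of g "- 1" c] by simp

lemma integrable_reflect:
  fixes f :: "real \<Rightarrow> complex"
  assumes "integrable lborel f" shows "integrable lborel (\<lambda>x. f (c - x))"
  using lborel_integrable_real_affine[OF assms, of "-1" c] by simp

text \<open>
  Fourier inversion is applied to the factor \<open>\<theta>\<close>, almost everywhere under the integral against \<open>f\<close>.
\<close>

lemma fourier_integral_mult:
  assumes f: "integrable lborel f" and \<theta>: "integrable lborel \<theta>"
    and X: "integrable lborel (fourier_integral \<theta>)"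
  shows "(LINT \<eta>|lborel. fourier_integral f \<eta> * fourier_integral \<theta> (\<xi> - \<eta>))
    = of_real (2 * pi) * fourier_integral (\<lambda>x. \<theta> x * f x) \<xi>"
proof -
  have [measurable]: "f \<in> borel_measurable borel" "\<theta> \<in> borel_measurable borel" using f \<theta> by auto
  define k :: "real \<times> real \<Rightarrow> complex" where "k = (\<lambda>(\<eta>, y). cis (- (y * \<eta>)))"
  have "(LINT \<eta>|lborel. fourier_integral f \<eta> * fourier_integral \<theta> (\<xi> - \<eta>))
     = (LINT \<eta>|lborel. fourier_integral \<theta> (\<xi> - \<eta>) * (LINT y|lborel. f y * k (\<eta>, y)))"
    by (simp add: fourier_integral_lborel k_def mult.commute)
  also have "\<dots> = (LINT y|lborel. f y * (LINT \<eta>|lborel. fourier_integral \<theta> (\<xi> - \<eta>) * k (\<eta>, y)))"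
  proof (rule Fubini_mult_bounded[OF _ f, where B=1])
    show "integrable lborel (\<lambda>\<eta>. fourier_integral \<theta> (\<xi> - \<eta>))" by (rule integrable_reflect[OF X])
    show "k \<in> borel_measurable borel" unfolding k_def borel_prod[symmetric] by measurable
  qed (auto simp: k_def)
  also have "\<dots> = (LINT y|lborel. of_real (2 * pi) * (\<theta> y * f y * cis (- (y * \<xi>))))"
  proof (rule integral_cong_AE)
    show "(\<lambda>y. f y * (LINT \<eta>|lborel. fourier_integral \<theta> (\<xi> - \<eta>) * k (\<eta>, y))) \<in> borel_measurable lborel"
      unfolding k_def by measurable
    have inner: "(LINT \<eta>|lborel. fourier_integral \<theta> (\<xi> - \<eta>) * k (\<eta>, y))
        = (LINT \<zeta>|lborel. fourier_integral \<theta> \<zeta> * cis (y * \<zeta>)) * cis (- (y * \<xi>))" for y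
    proof -
      have "(LINT \<eta>|lborel. fourier_integral \<theta> (\<xi> - \<eta>) * k (\<eta>, y))
        = (LINT \<zeta>|lborel. fourier_integral \<theta> (\<xi> - (\<xi> + (- 1) * \<zeta>)) * k (\<xi> + (- 1) * \<zeta>, y))"
        by (subst lborel_integral_real_affine[where c="-1" and t=\<xi>]) auto
      also have "\<dots> = (LINT \<zeta>|lborel. fourier_integral \<theta> \<zeta> * cis (y * \<zeta>) * cis (- (y * \<xi>)))"
        by (simp add: k_def cis_mult mult.assoc algebra_simps)
      finally show ?thesis by simp
    qed
    show "AE y in lborel. f y * (LINT \<eta>|lborel. fourier_integral \<theta> (\<xi> - \<eta>) * k (\<eta>, y))
      = of_real (2 * pi) * (\<theta> y * f y * cis (- (y * \<xi>)))"
      using fourier_inversion_AE[OF \<theta> X] by eventually_elim (simp add: inner)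
  qed measurable
  also have "\<dots> = of_real (2 * pi) * fourier_integral (\<lambda>x. \<theta> x * f x) \<xi>"
    by (simp add: fourier_integral_lborel)
  finally show ?thesis .
qed

text \<open>
  This is the Fourier form of the fact that the commutator of a smooth function with the
  operator of symbol \<open>\<bar>\<xi>\<bar> powr \<alpha>\<close> gains \<open>1 - \<alpha>\<close> derivatives. The number
  \<open>a powr (1 - \<alpha>) * b powr \<alpha>\<close> is a weighted geometric mean and so lies between \<open>a\<close> and \<open>b\<close>.
\<close>

lemma powr_symbol_difference:
  fixes a b \<alpha> :: real
  assumes "0 \<le> a" "0 \<le> b" "0 < \<alpha>" "\<alpha> < 1"
  shows "a powr (1 - \<alpha>) * \<bar>a powr \<alpha> - b powr \<alpha>\<bar> \<le> \<bar>a - b\<bar>"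
proof -
  have id: "x powr (1 - \<alpha>) * x powr \<alpha> = x" if "0 \<le> x" for x
    using that by (simp flip: powr_add)
  define P where "P = a powr (1 - \<alpha>) * b powr \<alpha>"
  have "min a b \<le> P \<and> P \<le> max a b"
  proof (cases "a \<le> b")
    case True
    have "a powr (1 - \<alpha>) * a powr \<alpha> \<le> P" "P \<le> b powr (1 - \<alpha>) * b powr \<alpha>"
      unfolding P_def using assms True by (auto intro!: mult_mono powr_mono2)
    then show ?thesis using True assms by (simp add: id)
  next
    case False
    have "b powr (1 - \<alpha>) * b powr \<alpha> \<le> P" "P \<le> a powr (1 - \<alpha>) * a powr \<alpha>"
      unfolding P_def using assms False by (auto intro!: mult_mono powr_mono2)
    then show ?thesis using False assms by (simp add: id)
  qed
  moreover have "a powr (1 - \<alpha>) * \<bar>a powr \<alpha> - b powr \<alpha>\<bar> = \<bar>a powr (1 - \<alpha>) * (a powr \<alpha> - b powr \<alpha>)\<bar>"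
    by (simp add: abs_mult)
  then have "a powr (1 - \<alpha>) * \<bar>a powr \<alpha> - b powr \<alpha>\<bar> = \<bar>a - P\<bar>"
    by (simp only: right_diff_distrib id[OF assms(1)] P_def)
  ultimately show ?thesis by (auto simp: min_def max_def split: if_splits)
qed

text \<open>
  The gap between the symbol and the eigenvalue \<open>\<mu> powr \<alpha>\<close>, scaled by \<open>a powr (1 - \<alpha>)\<close>, vanishes
  only at \<open>0\<close> and \<open>\<mu>\<close>, and grows linearly in the distance from them. The proof rests on the weighted arithmetic-geometric mean inequality for the two
  geometric means \<open>P\<close> and \<open>Q\<close> of \<open>a\<close> and \<open>\<mu>\<close>, whose product is \<open>a * \<mu>\<close>.
\<close>

lemma powr_symbol_gap:
  fixes a \<mu> \<alpha> :: real
  assumes "0 < a" "0 < \<mu>" "a \<noteq> \<mu>" "0 < \<alpha>" "\<alpha> < 1"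
  shows "\<alpha> \<le> a powr (1 - \<alpha>) * \<bar>a powr \<alpha> - \<mu> powr \<alpha>\<bar> * (1 / a + 1 / \<bar>a - \<mu>\<bar>)"
proof -
  define P where "P = a powr (1 - \<alpha>) * \<mu> powr \<alpha>"
  define Q where "Q = a powr \<alpha> * \<mu> powr (1 - \<alpha>)"
  have "a powr (1 - \<alpha>) * a powr \<alpha> = a" using assms by (simp flip: powr_add)
  moreover have "a powr (1 - \<alpha>) * \<bar>a powr \<alpha> - \<mu> powr \<alpha>\<bar> = \<bar>a powr (1 - \<alpha>) * (a powr \<alpha> - \<mu> powr \<alpha>)\<bar>"
    by (simp add: abs_mult)
  ultimately have B: "a powr (1 - \<alpha>) * \<bar>a powr \<alpha> - \<mu> powr \<alpha>\<bar> = \<bar>a - P\<bar>"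
    by (simp only: right_diff_distrib P_def)
  have "P * Q = (a powr (1 - \<alpha>) * a powr \<alpha>) * (\<mu> powr \<alpha> * \<mu> powr (1 - \<alpha>))"
    by (simp add: P_def Q_def)
  then have PQ: "P * Q = a * \<mu>" using assms by (simp flip: powr_add)
  have P: "P \<le> (1 - \<alpha>) * a + \<alpha> * \<mu>" and Q: "Q \<le> \<alpha> * a + (1 - \<alpha>) * \<mu>"
    using assms unfolding P_def Q_def by (auto intro!: Youngs_inequality_0)
  have "0 < P" using assms by (simp add: P_def)
  show ?thesis
  proof (cases "\<mu> < a")
    case True
    have "\<alpha> * (a - \<mu>) \<le> \<bar>a - P\<bar>" using P by (simp add: algebra_simps)
    then have "\<alpha> \<le> \<bar>a - P\<bar> * (1 / \<bar>a - \<mu>\<bar>)" using True by (simp add: pos_le_divide_eq)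
    also have "\<dots> \<le> \<bar>a - P\<bar> * (1 / a + 1 / \<bar>a - \<mu>\<bar>)"
      using assms by (intro mult_left_mono) auto
    finally show ?thesis unfolding B .
  next
    case False
    then have "a < \<mu>" using assms by simp
    define R where "R = \<alpha> * a + (1 - \<alpha>) * \<mu>"
    have "0 < R" using assms by (simp add: R_def add_pos_pos)
    have R_le: "R \<le> \<mu>"
      using mult_left_mono[of a \<mu> \<alpha>] \<open>a < \<mu>\<close> assms by (simp add: R_def algebra_simps)
    have "a * \<mu> \<le> P * R" using PQ Q \<open>0 < P\<close> by (metis R_def mult_left_mono less_imp_le)
    then have "\<alpha> * a * (\<mu> - a) \<le> (P - a) * R" by (simp add: R_def algebra_simps)
    moreover have "0 \<le> \<alpha> * a * (\<mu> - a)" using assms \<open>a < \<mu>\<close> by simp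
    ultimately have "0 \<le> P - a" using \<open>0 < R\<close> by (metis order_trans zero_le_mult_iff not_le)
    then have "(P - a) * R \<le> (P - a) * \<mu>" using R_le by (intro mult_left_mono)
    with \<open>\<alpha> * a * (\<mu> - a) \<le> (P - a) * R\<close> have "\<alpha> * (a * (\<mu> - a)) \<le> \<bar>a - P\<bar> * \<mu>"
      using \<open>0 \<le> P - a\<close> by (simp add: mult.assoc)
    moreover have "0 < a * (\<mu> - a)" using assms \<open>a < \<mu>\<close> by simp
    ultimately have "\<alpha> \<le> \<bar>a - P\<bar> * \<mu> / (a * (\<mu> - a))" by (simp add: pos_le_divide_eq)
    also have "\<dots> = \<bar>a - P\<bar> * (1 / a + 1 / \<bar>a - \<mu>\<bar>)"
      using assms \<open>a < \<mu>\<close> by (simp add: field_simps)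
    finally show ?thesis unfolding B .
  qed
qed

text \<open>
  Near the resonances \<open>\<xi> = \<mu>\<close>, \<open>\<xi> = - \<mu>\<close> and near \<open>\<xi> = 0\<close>, where the symbol gap is useless, the
  summand 1 in the first factor takes over. The point is that the second factor is square
  integrable with a norm bounded independently of \<open>\<mu>\<close>.
\<close>

lemma resolvent_weight:
  fixes \<xi> \<mu> \<alpha> :: real
  assumes "0 < \<mu>" "0 < \<alpha>" "\<alpha> < 1"
  shows "1 \<le> (1 + \<bar>\<xi>\<bar> powr (1 - \<alpha>) * \<bar>\<bar>\<xi>\<bar> powr \<alpha> - \<mu> powr \<alpha>\<bar>)
     * (2 / \<alpha> * (1 / (1 + \<bar>\<xi>\<bar>) + 1 / (1 + \<bar>\<xi> - \<mu>\<bar>) + 1 / (1 + \<bar>\<xi> + \<mu>\<bar>)))"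
proof -
  define a t where "a = \<bar>\<xi>\<bar>" and "t = \<bar>a - \<mu>\<bar>"
  define B where "B = a powr (1 - \<alpha>) * \<bar>a powr \<alpha> - \<mu> powr \<alpha>\<bar>"
  define w where "w = 1 / (1 + a) + 1 / (1 + t)"
  have "0 \<le> a" "0 \<le> t" "0 \<le> B" by (auto simp: a_def t_def B_def)
  have w0: "0 \<le> w" using \<open>0 \<le> a\<close> \<open>0 \<le> t\<close> by (simp add: w_def)
  have "1 \<le> (1 + B) * (2 / \<alpha> * w)"
  proof (cases "a \<le> 1 \<or> t \<le> 1")
    case True
    have h: "1 / 2 \<le> 1 / (1 + y)" if "0 \<le> y" "y \<le> 1" for y :: real
      using that by (simp add: field_simps)
    have "0 \<le> 1 / (1 + a)" "0 \<le> 1 / (1 + t)" using \<open>0 \<le> a\<close> \<open>0 \<le> t\<close> by auto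
    with True h[of a] h[of t] \<open>0 \<le> a\<close> \<open>0 \<le> t\<close> have "1 / 2 \<le> w" unfolding w_def by linarith
    moreover have "2 \<le> 2 / \<alpha>" using assms by (simp add: pos_le_divide_eq)
    ultimately have "2 * (1 / 2) \<le> 2 / \<alpha> * w" using w0 assms by (intro mult_mono) auto
    then show ?thesis
      using mult_mono[of 1 "1 + B" 1 "2 / \<alpha> * w"] \<open>0 \<le> B\<close> by simp
  next
    case False
    then have "1 < a" "1 < t" by auto
    have "(1 / a + 1 / t) / 2 \<le> w"
    proof -
      have "1 / y / 2 \<le> 1 / (1 + y)" if "1 < y" for y :: real
        using that by (simp add: field_simps)
      from this[OF \<open>1 < a\<close>] this[OF \<open>1 < t\<close>] show ?thesis by (simp add: w_def add_divide_distrib)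
    qed
    then have "B * (1 / a + 1 / t) \<le> B * (2 * w)"
      using \<open>0 \<le> B\<close> by (intro mult_left_mono) auto
    moreover have "\<alpha> \<le> B * (1 / a + 1 / t)"
      unfolding B_def t_def using \<open>1 < a\<close> \<open>1 < t\<close> assms by (intro powr_symbol_gap) (auto simp: t_def)
    ultimately have "\<alpha> \<le> B * (2 * w)" by (rule order_trans[rotated])
    then have "1 \<le> B * (2 / \<alpha> * w)" using assms by (simp add: field_simps)
    also have "\<dots> \<le> (1 + B) * (2 / \<alpha> * w)" using w0 assms by (intro mult_right_mono) auto
    finally show ?thesis .
  qed
  also have "\<dots> \<le> (1 + B) * (2 / \<alpha> * (1 / (1 + \<bar>\<xi>\<bar>) + 1 / (1 + \<bar>\<xi> - \<mu>\<bar>) + 1 / (1 + \<bar>\<xi> + \<mu>\<bar>)))"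
  proof -
    have "w \<le> 1 / (1 + \<bar>\<xi>\<bar>) + 1 / (1 + \<bar>\<xi> - \<mu>\<bar>) + 1 / (1 + \<bar>\<xi> + \<mu>\<bar>)"
    proof -
      have "t = \<bar>\<xi> - \<mu>\<bar> \<or> t = \<bar>\<xi> + \<mu>\<bar>" by (auto simp: t_def a_def abs_if)
      then show ?thesis by (auto simp: w_def a_def)
    qed
    then show ?thesis using assms \<open>0 \<le> B\<close> by (intro mult_left_mono) auto
  qed
  finally show ?thesis by (simp only: B_def a_def)
qed

text \<open>
  Young's inequality, by the Cauchy-Schwarz inequality in \<open>\<eta>\<close> with respect to the density
  \<open>\<psi> (\<xi> - \<eta>)\<close>. The kernel is real so that its square root is available.
\<close>

lemma convolution_L1_L2:
  fixes \<psi> :: "real \<Rightarrow> real" and g :: "real \<Rightarrow> ennreal"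
  assumes [measurable]: "\<psi> \<in> borel_measurable borel" "g \<in> borel_measurable borel"
    and \<psi>: "\<And>x. 0 \<le> \<psi> x"
  shows "(\<integral>\<^sup>+\<xi>. (\<integral>\<^sup>+\<eta>. ennreal (\<psi> (\<xi> - \<eta>)) * g \<eta> \<partial>lborel)\<^sup>2 \<partial>lborel)
     \<le> (\<integral>\<^sup>+x. ennreal (\<psi> x) \<partial>lborel)\<^sup>2 * (\<integral>\<^sup>+x. (g x)\<^sup>2 \<partial>lborel)"
proof -
  define P where "P = (\<integral>\<^sup>+x. ennreal (\<psi> x) \<partial>lborel)"
  have sq: "(ennreal (sqrt (\<psi> x)))\<^sup>2 = ennreal (\<psi> x)" for x
    using \<psi>[of x] by (simp add: ennreal_power)
  have "(\<integral>\<^sup>+\<eta>. ennreal (\<psi> (\<xi> - \<eta>)) * g \<eta> \<partial>lborel)\<^sup>2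
    \<le> P * (\<integral>\<^sup>+\<eta>. ennreal (\<psi> (\<xi> - \<eta>)) * (g \<eta>)\<^sup>2 \<partial>lborel)" for \<xi>
  proof -
    have "(\<integral>\<^sup>+\<eta>. ennreal (sqrt (\<psi> (\<xi> - \<eta>))) * (ennreal (sqrt (\<psi> (\<xi> - \<eta>))) * g \<eta>) \<partial>lborel)\<^sup>2
      \<le> (\<integral>\<^sup>+\<eta>. (ennreal (sqrt (\<psi> (\<xi> - \<eta>))))\<^sup>2 \<partial>lborel) * (\<integral>\<^sup>+\<eta>. (ennreal (sqrt (\<psi> (\<xi> - \<eta>))) * g \<eta>)\<^sup>2 \<partial>lborel)"
      by (rule Cauchy_Schwarz_nn_integral) measurable
    also have "(\<integral>\<^sup>+\<eta>. (ennreal (sqrt (\<psi> (\<xi> - \<eta>))))\<^sup>2 \<partial>lborel) = P"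
      unfolding sq P_def by (rule nn_integral_reflect) measurable
    finally show ?thesis
      by (simp add: power_mult_distrib sq flip: mult.assoc power2_eq_square)
  qed
  then have "(\<integral>\<^sup>+\<xi>. (\<integral>\<^sup>+\<eta>. ennreal (\<psi> (\<xi> - \<eta>)) * g \<eta> \<partial>lborel)\<^sup>2 \<partial>lborel)
     \<le> (\<integral>\<^sup>+\<xi>. P * (\<integral>\<^sup>+\<eta>. ennreal (\<psi> (\<xi> - \<eta>)) * (g \<eta>)\<^sup>2 \<partial>lborel) \<partial>lborel)"
    by (rule nn_integral_mono)
  also have "\<dots> = P * (\<integral>\<^sup>+\<xi>. (\<integral>\<^sup>+\<eta>. ennreal (\<psi> (\<xi> - \<eta>)) * (g \<eta>)\<^sup>2 \<partial>lborel) \<partial>lborel)"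
    by (rule nn_integral_cmult) measurable
  also have "(\<integral>\<^sup>+\<xi>. (\<integral>\<^sup>+\<eta>. ennreal (\<psi> (\<xi> - \<eta>)) * (g \<eta>)\<^sup>2 \<partial>lborel) \<partial>lborel)
     = (\<integral>\<^sup>+\<eta>. (\<integral>\<^sup>+\<xi>. ennreal (\<psi> (\<xi> - \<eta>)) * (g \<eta>)\<^sup>2 \<partial>lborel) \<partial>lborel)"
    by (rule lborel_pair.Fubini') measurable
  also have "\<dots> = (\<integral>\<^sup>+\<eta>. P * (g \<eta>)\<^sup>2 \<partial>lborel)"
    by (simp add: nn_integral_multc nn_integral_shift[of "\<lambda>x. ennreal (\<psi> x)"] P_def)
  also have "\<dots> = P * (\<integral>\<^sup>+\<eta>. (g \<eta>)\<^sup>2 \<partial>lborel)"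
    by (rule nn_integral_cmult) measurable
  finally show ?thesis by (simp add: P_def power2_eq_square mult.assoc)
qed


text \<open>
  Each of the three translates contributes the same integral, so the bound is uniform in \<open>\<mu>\<close>.
  The constant is the square of \<open>2 / \<alpha>\<close>, times 3 for squaring a sum of three terms, times 3 for
  the number of translates.
\<close>

lemma resolvent_weight_L2:
  fixes \<mu> \<alpha> :: real
  assumes "0 < \<alpha>"
  shows "(\<integral>\<^sup>+\<xi>. (ennreal (2 / \<alpha> * (1 / (1 + \<bar>\<xi>\<bar>) + 1 / (1 + \<bar>\<xi> - \<mu>\<bar>) + 1 / (1 + \<bar>\<xi> + \<mu>\<bar>))))\<^sup>2 \<partial>lborel)
    \<le> ennreal (36 / \<alpha>\<^sup>2) * (\<integral>\<^sup>+\<xi>. ennreal (inverse (1 + \<xi>\<^sup>2)) \<partial>lborel)"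
proof -
  define q where "q x = ennreal (inverse (1 + x\<^sup>2))" for x :: real
  have q [measurable]: "q \<in> borel_measurable borel" unfolding q_def by measurable
  have sq: "(1 / (1 + \<bar>x\<bar>))\<^sup>2 \<le> inverse (1 + x\<^sup>2)" for x :: real
  proof -
    have "1 + x\<^sup>2 \<le> (1 + \<bar>x\<bar>)\<^sup>2" by (simp add: power2_sum)
    then have "inverse ((1 + \<bar>x\<bar>)\<^sup>2) \<le> inverse (1 + x\<^sup>2)"
      by (rule le_imp_inverse_le) (simp add: add_pos_nonneg)
    then show ?thesis by (simp add: power_divide inverse_eq_divide)
  qed
  have "(ennreal (2 / \<alpha> * (1 / (1 + \<bar>\<xi>\<bar>) + 1 / (1 + \<bar>\<xi> - \<mu>\<bar>) + 1 / (1 + \<bar>\<xi> + \<mu>\<bar>))))\<^sup>2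
     \<le> ennreal (12 / \<alpha>\<^sup>2) * (q \<xi> + q (\<xi> - \<mu>) + q (\<xi> - (- \<mu>)))" for \<xi>
  proof -
    have three: "(a + b + c)\<^sup>2 \<le> 3 * (a\<^sup>2 + b\<^sup>2 + c\<^sup>2)" for a b c :: real
      using sum_squares_bound[of a b] sum_squares_bound[of a c] sum_squares_bound[of b c]
      by (simp add: power2_eq_square algebra_simps)
    have "(2 / \<alpha> * (1 / (1 + \<bar>\<xi>\<bar>) + 1 / (1 + \<bar>\<xi> - \<mu>\<bar>) + 1 / (1 + \<bar>\<xi> + \<mu>\<bar>)))\<^sup>2
      = (2 / \<alpha>)\<^sup>2 * (1 / (1 + \<bar>\<xi>\<bar>) + 1 / (1 + \<bar>\<xi> - \<mu>\<bar>) + 1 / (1 + \<bar>\<xi> + \<mu>\<bar>))\<^sup>2"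
      by (rule power_mult_distrib)
    also have "\<dots> \<le> (2 / \<alpha>)\<^sup>2 * (3 * ((1 / (1 + \<bar>\<xi>\<bar>))\<^sup>2 + (1 / (1 + \<bar>\<xi> - \<mu>\<bar>))\<^sup>2 + (1 / (1 + \<bar>\<xi> + \<mu>\<bar>))\<^sup>2))"
      by (intro mult_left_mono three) auto
    also have "\<dots> \<le> (2 / \<alpha>)\<^sup>2 * (3 * (inverse (1 + \<xi>\<^sup>2) + inverse (1 + (\<xi> - \<mu>)\<^sup>2) + inverse (1 + (\<xi> + \<mu>)\<^sup>2)))"
      by (intro mult_left_mono add_mono sq) auto
    also have "\<dots> = 12 / \<alpha>\<^sup>2 * (inverse (1 + \<xi>\<^sup>2) + inverse (1 + (\<xi> - \<mu>)\<^sup>2) + inverse (1 + (\<xi> + \<mu>)\<^sup>2))"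
      by (simp add: power_divide)
    finally have "ennreal ((2 / \<alpha> * (1 / (1 + \<bar>\<xi>\<bar>) + 1 / (1 + \<bar>\<xi> - \<mu>\<bar>) + 1 / (1 + \<bar>\<xi> + \<mu>\<bar>)))\<^sup>2)
      \<le> ennreal (12 / \<alpha>\<^sup>2 * (inverse (1 + \<xi>\<^sup>2) + inverse (1 + (\<xi> - \<mu>)\<^sup>2) + inverse (1 + (\<xi> + \<mu>)\<^sup>2)))"
      by (rule ennreal_leI)
    also have "\<dots> = ennreal (12 / \<alpha>\<^sup>2) * (q \<xi> + q (\<xi> - \<mu>) + q (\<xi> - (- \<mu>)))"
      unfolding q_def by (subst ennreal_mult') (auto simp: ennreal_plus)
    finally show ?thesis using assms by (subst ennreal_power) auto
  qed
  then have "(\<integral>\<^sup>+\<xi>. (ennreal (2 / \<alpha> * (1 / (1 + \<bar>\<xi>\<bar>) + 1 / (1 + \<bar>\<xi> - \<mu>\<bar>) + 1 / (1 + \<bar>\<xi> + \<mu>\<bar>))))\<^sup>2 \<partial>lborel)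
    \<le> (\<integral>\<^sup>+\<xi>. ennreal (12 / \<alpha>\<^sup>2) * (q \<xi> + q (\<xi> - \<mu>) + q (\<xi> - (- \<mu>))) \<partial>lborel)"
    by (rule nn_integral_mono)
  also have "\<dots> = ennreal (12 / \<alpha>\<^sup>2) * ((\<integral>\<^sup>+\<xi>. q \<xi> \<partial>lborel) + (\<integral>\<^sup>+\<xi>. q \<xi> \<partial>lborel) + (\<integral>\<^sup>+\<xi>. q \<xi> \<partial>lborel))"
    by (subst nn_integral_cmult, simp, subst nn_integral_add, simp, simp, subst nn_integral_add, simp, simp)
      (simp only: nn_integral_shift[OF q])
  also have "\<dots> = ennreal (12 / \<alpha>\<^sup>2) * (3 * (\<integral>\<^sup>+\<xi>. q \<xi> \<partial>lborel))"
  proof -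
    have "(3::ennreal) = 1 + 1 + 1" by simp
    then show ?thesis by (simp only: distrib_right mult_1_left)
  qed
  also have "\<dots> = ennreal (36 / \<alpha>\<^sup>2) * (\<integral>\<^sup>+\<xi>. q \<xi> \<partial>lborel)"
  proof -
    have "ennreal (36 / \<alpha>\<^sup>2) = ennreal (12 / \<alpha>\<^sup>2 * 3)" by simp
    also have "\<dots> = ennreal (12 / \<alpha>\<^sup>2) * 3" by (subst ennreal_mult') auto
    finally show ?thesis by (simp add: mult.assoc)
  qed
  finally show ?thesis unfolding q_def .
qed

text \<open>
  The hypothesis on \<open>u\<close> is the eigenvalue equation with eigenvalue \<open>\<mu> powr \<alpha>\<close>, tested with the
  modulated cut-offs \<open>\<lambda>x. \<theta> x * cis (- (x * \<xi>))\<close>. Let \<open>U\<close>, \<open>T\<close>, \<open>V\<close> be the Fourier transforms of \<open>u\<close>,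
  \<open>\<theta>\<close> and the product \<open>\<theta> u\<close>. Subtracting the equation from \<open>\<bar>\<xi>\<bar> powr \<alpha>\<close> times the convolution formula
  for \<open>V\<close> leaves a commutator with kernel \<open>(\<bar>\<xi>\<bar> powr \<alpha> - \<bar>\<eta>\<bar> powr \<alpha>) T (\<xi> - \<eta>)\<close>, and
  \<open>powr_symbol_difference\<close> trades the difference of symbols for \<open>\<bar>\<xi> - \<eta>\<bar>\<close>, which the decay of \<open>T\<close>
  absorbs. So \<open>V\<close>, even multiplied by the symbol gap, is dominated by the convolution \<open>H\<close> of
  \<open>\<bar>U\<bar>\<close> with an integrable kernel. The weight \<open>W\<close> of \<open>resolvent_weight\<close> then turns the \<open>L\<^sup>2\<close> bound
  for \<open>H\<close> into an \<open>L\<^sup>1\<close> bound for \<open>V\<close>, uniformly in \<open>\<mu>\<close>.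
\<close>

theorem localized_eigenfunction_fourier_L1:
  fixes \<alpha> C :: real and \<theta> :: "real \<Rightarrow> complex"
  assumes \<alpha>: "0 < \<alpha>" "\<alpha> < 1" and \<theta>: "integrable lborel \<theta>"
    and decay: "\<And>\<xi>. (1 + \<bar>\<xi>\<bar>) * norm (fourier_integral \<theta> \<xi>) \<le> C * inverse (1 + \<xi>\<^sup>2)"
  shows "\<exists>K\<ge>0. \<forall>\<mu> u. 0 < \<mu> \<longrightarrow> integrable lborel u \<longrightarrow>
    (\<forall>\<xi>. (LINT \<eta>|lborel. of_real (\<bar>\<eta>\<bar> powr \<alpha>) * fourier_integral u \<eta> * fourier_integral \<theta> (\<xi> - \<eta>)) / of_real (2 * pi)
       = of_real (\<mu> powr \<alpha>) * fourier_integral (\<lambda>x. \<theta> x * u x) \<xi>) \<longrightarrow>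
    (\<integral>\<^sup>+\<xi>. ennreal (norm (fourier_integral (\<lambda>x. \<theta> x * u x) \<xi>)) \<partial>lborel)\<^sup>2
      \<le> ennreal K * (\<integral>\<^sup>+x. ennreal ((norm (u x))\<^sup>2) \<partial>lborel)"
proof -
  have [measurable]: "\<theta> \<in> borel_measurable borel" using \<theta> by auto
  define T where "T = fourier_integral \<theta>"
  have [measurable]: "T \<in> borel_measurable borel" unfolding T_def by measurable
  define \<psi> where "\<psi> x = (1 + \<bar>x\<bar>) * norm (T x)" for x
  have [measurable]: "\<psi> \<in> borel_measurable borel" unfolding \<psi>_def by measurable
  have \<psi>0: "0 \<le> \<psi> x" for x by (simp add: \<psi>_def)
  have i\<psi>: "integrable lborel \<psi>"
    by (rule Bochner_Integration.integrable_bound[OF integrable_mult_right[OF integrable_inverse_1_plus_square_lborel, of C]])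
      (use order_trans[OF decay abs_ge_self] in \<open>auto simp: \<psi>_def T_def abs_mult\<close>)
  have T_le: "norm (T x) \<le> \<psi> x" for x
    by (simp add: \<psi>_def mult_le_cancel_right1)
  have iT: "integrable lborel T"
    by (rule Bochner_Integration.integrable_bound[OF i\<psi>]) (use T_le \<psi>0 in auto)
  define P where "P = (LINT x|lborel. \<psi> x)"
  have P: "(\<integral>\<^sup>+x. ennreal (\<psi> x) \<partial>lborel) = ennreal P" "0 \<le> P"
    unfolding P_def using nn_integral_eq_integral[OF i\<psi>] \<psi>0 by auto
  define Q where "Q = (LINT x|lborel. inverse (1 + x\<^sup>2 :: real))"
  have Q: "(\<integral>\<^sup>+x. ennreal (inverse (1 + x\<^sup>2)) \<partial>lborel) = ennreal Q" "0 \<le> Q"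
    unfolding Q_def using nn_integral_eq_integral[OF integrable_inverse_1_plus_square_lborel] by auto
  define K where "K = (36 / \<alpha>\<^sup>2 * Q) * (P\<^sup>2 * (2 * pi))"
  have K0: "0 \<le> K" using Q P by (simp add: K_def)
  show ?thesis
  proof (intro exI[of _ K] conjI K0 allI impI)
    fix \<mu> :: real and u :: "real \<Rightarrow> complex"
    assume \<mu>: "0 < \<mu>" and u: "integrable lborel u"
      and eq: "\<forall>\<xi>. (LINT \<eta>|lborel. of_real (\<bar>\<eta>\<bar> powr \<alpha>) * fourier_integral u \<eta> * fourier_integral \<theta> (\<xi> - \<eta>)) / of_real (2 * pi)
       = of_real (\<mu> powr \<alpha>) * fourier_integral (\<lambda>x. \<theta> x * u x) \<xi>"
    have [measurable]: "u \<in> borel_measurable borel" using u by auto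
    define U where "U = fourier_integral u"
    have [measurable]: "U \<in> borel_measurable borel" unfolding U_def by measurable
    define V where "V = fourier_integral (\<lambda>x. \<theta> x * u x)"
    have [measurable]: "V \<in> borel_measurable borel" unfolding V_def by measurable
    define L where "L = (LINT x|lborel. norm (u x))"
    have UL: "norm (U \<eta>) \<le> L" for \<eta> unfolding U_def L_def by (rule norm_fourier_integral_le[OF u])
    have "0 \<le> L" by (simp add: L_def)
    have i\<psi>': "integrable lborel (\<lambda>\<eta>. \<psi> (\<xi> - \<eta>))" for \<xi>
      using lborel_integrable_real_affine[OF i\<psi>, of "-1" \<xi>] by simp
    have i1: "integrable lborel (\<lambda>\<eta>. of_real (\<bar>\<eta>\<bar> powr \<alpha>) * U \<eta> * T (\<xi> - \<eta>))" for \<xi>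
    proof (rule Bochner_Integration.integrable_bound)
      show "integrable lborel (\<lambda>\<eta>. ((2 + \<bar>\<xi>\<bar>) * L) * \<psi> (\<xi> - \<eta>))" by (intro integrable_mult_right i\<psi>')
      show "AE \<eta> in lborel. norm (of_real (\<bar>\<eta>\<bar> powr \<alpha>) * U \<eta> * T (\<xi> - \<eta>)) \<le> norm (((2 + \<bar>\<xi>\<bar>) * L) * \<psi> (\<xi> - \<eta>))"
      proof (rule AE_I2)
        fix \<eta>
        have "\<bar>\<eta>\<bar> powr \<alpha> \<le> (1 + \<bar>\<eta>\<bar>) powr \<alpha>" using \<alpha> by (intro powr_mono2) auto
        also have "\<dots> \<le> (1 + \<bar>\<eta>\<bar>) powr 1" using \<alpha> by (intro powr_mono) auto
        also have "\<dots> \<le> (2 + \<bar>\<xi>\<bar>) * (1 + \<bar>\<xi> - \<eta>\<bar>)"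
        proof -
          have bound: "1 + h \<le> (2 + s) * (1 + t)" if "0 \<le> s" "0 \<le> t" "h \<le> s + t" for h s t :: real
          proof -
            have "1 + h \<le> 2 + s + 2 * t + s * t" using that mult_nonneg_nonneg[of s t] by linarith
            also have "\<dots> = (2 + s) * (1 + t)" by (simp add: algebra_simps)
            finally show ?thesis .
          qed
          have "1 + \<bar>\<eta>\<bar> \<le> (2 + \<bar>\<xi>\<bar>) * (1 + \<bar>\<xi> - \<eta>\<bar>)" by (rule bound) auto
          then show ?thesis by simp
        qed
        finally have TB: "\<bar>\<eta>\<bar> powr \<alpha> * norm (T (\<xi> - \<eta>)) \<le> (2 + \<bar>\<xi>\<bar>) * \<psi> (\<xi> - \<eta>)"
          by (simp add: \<psi>_def mult_right_mono flip: mult.assoc)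
        have "norm (U \<eta>) * (\<bar>\<eta>\<bar> powr \<alpha> * norm (T (\<xi> - \<eta>))) \<le> L * ((2 + \<bar>\<xi>\<bar>) * \<psi> (\<xi> - \<eta>))"
          by (rule mult_mono[OF UL TB]) (use \<open>0 \<le> L\<close> in auto)
        then show "norm (of_real (\<bar>\<eta>\<bar> powr \<alpha>) * U \<eta> * T (\<xi> - \<eta>)) \<le> norm (((2 + \<bar>\<xi>\<bar>) * L) * \<psi> (\<xi> - \<eta>))"
          using \<open>0 \<le> L\<close> \<psi>0 by (simp add: norm_mult abs_mult ac_simps)
      qed
    qed measurable
    have i2: "integrable lborel (\<lambda>\<eta>. U \<eta> * T (\<xi> - \<eta>))" for \<xi>
    proof (rule Bochner_Integration.integrable_bound)
      show "integrable lborel (\<lambda>\<eta>. L * \<psi> (\<xi> - \<eta>))" by (intro integrable_mult_right i\<psi>')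
      show "AE \<eta> in lborel. norm (U \<eta> * T (\<xi> - \<eta>)) \<le> norm (L * \<psi> (\<xi> - \<eta>))"
        using UL T_le \<open>0 \<le> L\<close> \<psi>0 by (intro AE_I2) (auto simp: norm_mult intro!: mult_mono)
    qed measurable
    have V: "V \<xi> = (LINT \<eta>|lborel. U \<eta> * T (\<xi> - \<eta>)) / of_real (2 * pi)" for \<xi>
      unfolding V_def U_def T_def by (subst fourier_integral_mult[OF u \<theta> iT[unfolded T_def]]) simp
    \<comment> \<open>\<open>B\<close> is the symbol gap, scaled by the gain of the commutator; \<open>BV\<close> is the commutator identity.\<close>
    define B where "B \<xi> = \<bar>\<xi>\<bar> powr (1 - \<alpha>) * \<bar>\<bar>\<xi>\<bar> powr \<alpha> - \<mu> powr \<alpha>\<bar>" for \<xi>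
    have B0: "0 \<le> B \<xi>" for \<xi> by (simp add: B_def)
    have BV: "of_real (\<bar>\<xi>\<bar> powr \<alpha> - \<mu> powr \<alpha>) * V \<xi>
      = (LINT \<eta>|lborel. of_real (\<bar>\<xi>\<bar> powr \<alpha> - \<bar>\<eta>\<bar> powr \<alpha>) * (U \<eta> * T (\<xi> - \<eta>))) / of_real (2 * pi)" for \<xi>
    proof -
      have "(LINT \<eta>|lborel. of_real (\<bar>\<xi>\<bar> powr \<alpha> - \<bar>\<eta>\<bar> powr \<alpha>) * (U \<eta> * T (\<xi> - \<eta>)))
        = (LINT \<eta>|lborel. of_real (\<bar>\<xi>\<bar> powr \<alpha>) * (U \<eta> * T (\<xi> - \<eta>)) - of_real (\<bar>\<eta>\<bar> powr \<alpha>) * U \<eta> * T (\<xi> - \<eta>))"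
        by (simp add: left_diff_distrib mult.assoc)
      also have "\<dots> = of_real (\<bar>\<xi>\<bar> powr \<alpha>) * (LINT \<eta>|lborel. U \<eta> * T (\<xi> - \<eta>)) - (LINT \<eta>|lborel. of_real (\<bar>\<eta>\<bar> powr \<alpha>) * U \<eta> * T (\<xi> - \<eta>))"
        using i2[of \<xi>] i1[of \<xi>] by (subst Bochner_Integration.integral_diff) auto
      also have "(LINT \<eta>|lborel. of_real (\<bar>\<eta>\<bar> powr \<alpha>) * U \<eta> * T (\<xi> - \<eta>)) = of_real (2 * pi) * (of_real (\<mu> powr \<alpha>) * V \<xi>)"
        using eq[rule_format, of \<xi>] unfolding U_def T_def V_def by (simp add: field_simps)
      also have "(LINT \<eta>|lborel. U \<eta> * T (\<xi> - \<eta>)) = of_real (2 * pi) * V \<xi>" unfolding V by simp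
      finally show ?thesis by (simp add: field_simps)
    qed
    define g where "g \<eta> = ennreal (norm (U \<eta>))" for \<eta>
    have [measurable]: "g \<in> borel_measurable borel" unfolding g_def by measurable
    define H where "H \<xi> = (\<integral>\<^sup>+\<eta>. ennreal (\<psi> (\<xi> - \<eta>)) * g \<eta> \<partial>lborel)" for \<xi>
    have [measurable]: "H \<in> borel_measurable borel" unfolding H_def by measurable
    have two_pi: "1 \<le> 2 * pi" using pi_ge_two by simp
    have nle: "ennreal (norm (z / of_real (2 * pi))) \<le> ennreal (norm z)" for z :: complex
      using two_pi by (intro ennreal_leI) (simp add: norm_divide divide_le_eq mult_le_cancel_left1)
    \<comment> \<open>The two parts of the weight \<open>1 + \<bar>\<xi> - \<eta>\<bar>\<close> in \<open>\<psi>\<close> control \<open>V\<close> and \<open>B * V\<close> respectively.\<close>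
    have VH: "ennreal (norm (V \<xi>) * (1 + B \<xi>)) \<le> H \<xi>" for \<xi>
    proof -
      have "ennreal (norm (V \<xi>)) \<le> (\<integral>\<^sup>+\<eta>. ennreal (norm (U \<eta> * T (\<xi> - \<eta>))) \<partial>lborel)"
        unfolding V by (rule order_trans[OF nle norm_integral_le_nn_integral])
      moreover have "ennreal (B \<xi> * norm (V \<xi>)) \<le> (\<integral>\<^sup>+\<eta>. ennreal (\<bar>\<xi> - \<eta>\<bar> * norm (U \<eta> * T (\<xi> - \<eta>))) \<partial>lborel)"
      proof -
        have "ennreal (B \<xi> * norm (V \<xi>)) = ennreal (\<bar>\<xi>\<bar> powr (1 - \<alpha>)) * ennreal (norm (of_real (\<bar>\<xi>\<bar> powr \<alpha> - \<mu> powr \<alpha>) * V \<xi>))"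
          unfolding B_def norm_mult norm_of_real by (subst ennreal_mult'[symmetric]) (auto simp: mult.assoc)
        also have "ennreal (norm (of_real (\<bar>\<xi>\<bar> powr \<alpha> - \<mu> powr \<alpha>) * V \<xi>))
          \<le> (\<integral>\<^sup>+\<eta>. ennreal (norm (of_real (\<bar>\<xi>\<bar> powr \<alpha> - \<bar>\<eta>\<bar> powr \<alpha>) * (U \<eta> * T (\<xi> - \<eta>)))) \<partial>lborel)"
          unfolding BV by (rule order_trans[OF nle norm_integral_le_nn_integral])
        also have "ennreal (\<bar>\<xi>\<bar> powr (1 - \<alpha>)) * \<dots>
          = (\<integral>\<^sup>+\<eta>. ennreal (\<bar>\<xi>\<bar> powr (1 - \<alpha>)) * ennreal (norm (of_real (\<bar>\<xi>\<bar> powr \<alpha> - \<bar>\<eta>\<bar> powr \<alpha>) * (U \<eta> * T (\<xi> - \<eta>)))) \<partial>lborel)"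
          by (rule nn_integral_cmult[symmetric]) measurable
        also have "\<dots> \<le> (\<integral>\<^sup>+\<eta>. ennreal (\<bar>\<xi> - \<eta>\<bar> * norm (U \<eta> * T (\<xi> - \<eta>))) \<partial>lborel)"
        proof (rule nn_integral_mono)
          fix \<eta>
          have "\<bar>\<xi>\<bar> powr (1 - \<alpha>) * \<bar>\<bar>\<xi>\<bar> powr \<alpha> - \<bar>\<eta>\<bar> powr \<alpha>\<bar> \<le> \<bar>\<bar>\<xi>\<bar> - \<bar>\<eta>\<bar>\<bar>"
            using \<alpha> by (intro powr_symbol_difference) auto
          also have "\<dots> \<le> \<bar>\<xi> - \<eta>\<bar>" by linarith
          finally have "\<bar>\<xi>\<bar> powr (1 - \<alpha>) * \<bar>\<bar>\<xi>\<bar> powr \<alpha> - \<bar>\<eta>\<bar> powr \<alpha>\<bar> * norm (U \<eta> * T (\<xi> - \<eta>)) \<le> \<bar>\<xi> - \<eta>\<bar> * norm (U \<eta> * T (\<xi> - \<eta>))"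
            by (rule mult_right_mono) simp
          then show "ennreal (\<bar>\<xi>\<bar> powr (1 - \<alpha>)) * ennreal (norm (of_real (\<bar>\<xi>\<bar> powr \<alpha> - \<bar>\<eta>\<bar> powr \<alpha>) * (U \<eta> * T (\<xi> - \<eta>))))
             \<le> ennreal (\<bar>\<xi> - \<eta>\<bar> * norm (U \<eta> * T (\<xi> - \<eta>)))"
            unfolding norm_mult[of "of_real _"] norm_of_real
            by (subst ennreal_mult'[symmetric]) (auto simp: mult.assoc intro!: ennreal_leI)
        qed
        finally show ?thesis by (simp add: mult_left_mono)
      qed
      ultimately have "ennreal (norm (V \<xi>)) + ennreal (B \<xi> * norm (V \<xi>))
        \<le> (\<integral>\<^sup>+\<eta>. ennreal (norm (U \<eta> * T (\<xi> - \<eta>))) \<partial>lborel) + (\<integral>\<^sup>+\<eta>. ennreal (\<bar>\<xi> - \<eta>\<bar> * norm (U \<eta> * T (\<xi> - \<eta>))) \<partial>lborel)"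
        by (rule add_mono)
      also have "\<dots> = (\<integral>\<^sup>+\<eta>. ennreal (norm (U \<eta> * T (\<xi> - \<eta>))) + ennreal (\<bar>\<xi> - \<eta>\<bar> * norm (U \<eta> * T (\<xi> - \<eta>))) \<partial>lborel)"
        by (rule nn_integral_add[symmetric]) measurable
      also have "\<dots> = H \<xi>"
        unfolding H_def
      proof (rule nn_integral_cong)
        fix \<eta>
        have "norm (U \<eta> * T (\<xi> - \<eta>)) + \<bar>\<xi> - \<eta>\<bar> * norm (U \<eta> * T (\<xi> - \<eta>)) = \<psi> (\<xi> - \<eta>) * norm (U \<eta>)"
          by (simp add: \<psi>_def norm_mult algebra_simps)
        then show "ennreal (norm (U \<eta> * T (\<xi> - \<eta>))) + ennreal (\<bar>\<xi> - \<eta>\<bar> * norm (U \<eta> * T (\<xi> - \<eta>))) = ennreal (\<psi> (\<xi> - \<eta>)) * g \<eta>"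
          using \<psi>0 by (subst ennreal_plus[symmetric]) (auto simp: g_def ennreal_mult)
      qed
      also have "ennreal (norm (V \<xi>)) + ennreal (B \<xi> * norm (V \<xi>)) = ennreal (norm (V \<xi>) * (1 + B \<xi>))"
        using B0[of \<xi>] by (subst ennreal_plus[symmetric]) (auto simp: algebra_simps)
      finally show ?thesis .
    qed
    define W where "W \<xi> = 2 / \<alpha> * (1 / (1 + \<bar>\<xi>\<bar>) + 1 / (1 + \<bar>\<xi> - \<mu>\<bar>) + 1 / (1 + \<bar>\<xi> + \<mu>\<bar>))" for \<xi>
    have [measurable]: "W \<in> borel_measurable borel" unfolding W_def by measurable
    have W0: "0 \<le> W \<xi>" for \<xi> using \<alpha> by (simp add: W_def)
    have "(\<integral>\<^sup>+\<xi>. ennreal (norm (V \<xi>)) \<partial>lborel) \<le> (\<integral>\<^sup>+\<xi>. H \<xi> * ennreal (W \<xi>) \<partial>lborel)"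
    proof (rule nn_integral_mono)
      fix \<xi>
      have "norm (V \<xi>) * 1 \<le> norm (V \<xi>) * ((1 + B \<xi>) * W \<xi>)"
        unfolding B_def W_def by (intro mult_left_mono resolvent_weight \<mu> \<alpha>) auto
      then have "ennreal (norm (V \<xi>)) \<le> ennreal (norm (V \<xi>) * (1 + B \<xi>) * W \<xi>)"
        by (intro ennreal_leI) (simp add: mult.assoc)
      also have "\<dots> = ennreal (norm (V \<xi>) * (1 + B \<xi>)) * ennreal (W \<xi>)"
        using W0 B0[of \<xi>] by (subst ennreal_mult) auto
      also have "\<dots> \<le> H \<xi> * ennreal (W \<xi>)" by (intro mult_right_mono VH) auto
      finally show "ennreal (norm (V \<xi>)) \<le> H \<xi> * ennreal (W \<xi>)" .
    qed
    then have "(\<integral>\<^sup>+\<xi>. ennreal (norm (V \<xi>)) \<partial>lborel)\<^sup>2 \<le> (\<integral>\<^sup>+\<xi>. H \<xi> * ennreal (W \<xi>) \<partial>lborel)\<^sup>2"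
      by (intro power_mono) auto
    also have "\<dots> \<le> (\<integral>\<^sup>+\<xi>. (H \<xi>)\<^sup>2 \<partial>lborel) * (\<integral>\<^sup>+\<xi>. (ennreal (W \<xi>))\<^sup>2 \<partial>lborel)"
      by (rule Cauchy_Schwarz_nn_integral) measurable
    also have "\<dots> \<le> ((ennreal P)\<^sup>2 * (ennreal (2 * pi) * (\<integral>\<^sup>+x. ennreal ((norm (u x))\<^sup>2) \<partial>lborel))) * (ennreal (36 / \<alpha>\<^sup>2) * ennreal Q)"
    proof (rule mult_mono)
      have "(\<integral>\<^sup>+\<xi>. (H \<xi>)\<^sup>2 \<partial>lborel) \<le> (ennreal P)\<^sup>2 * (\<integral>\<^sup>+x. (g x)\<^sup>2 \<partial>lborel)"
        unfolding H_def P(1)[symmetric] by (rule convolution_L1_L2) (auto intro: \<psi>0)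
      also have "(\<integral>\<^sup>+x. (g x)\<^sup>2 \<partial>lborel) \<le> ennreal (2 * pi) * (\<integral>\<^sup>+x. ennreal ((norm (u x))\<^sup>2) \<partial>lborel)"
        using bessel_fourier[OF u] by (simp add: g_def U_def ennreal_power)
      finally show "(\<integral>\<^sup>+\<xi>. (H \<xi>)\<^sup>2 \<partial>lborel) \<le> (ennreal P)\<^sup>2 * (ennreal (2 * pi) * (\<integral>\<^sup>+x. ennreal ((norm (u x))\<^sup>2) \<partial>lborel))"
        by (simp add: mult_left_mono)
      show "(\<integral>\<^sup>+\<xi>. (ennreal (W \<xi>))\<^sup>2 \<partial>lborel) \<le> ennreal (36 / \<alpha>\<^sup>2) * ennreal Q"
        unfolding Q(1)[symmetric] W_def by (rule resolvent_weight_L2[OF \<alpha>(1)])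
    qed auto
    also have "\<dots> = ennreal K * (\<integral>\<^sup>+x. ennreal ((norm (u x))\<^sup>2) \<partial>lborel)"
    proof -
      have "ennreal K = (ennreal (36 / \<alpha>\<^sup>2) * ennreal Q) * ((ennreal P)\<^sup>2 * ennreal (2 * pi))"
      proof -
        have "ennreal K = ennreal (36 / \<alpha>\<^sup>2 * Q) * ennreal (P\<^sup>2 * (2 * pi))"
          unfolding K_def using P(2) Q(2) by (intro ennreal_mult) auto
        also have "ennreal (36 / \<alpha>\<^sup>2 * Q) = ennreal (36 / \<alpha>\<^sup>2) * ennreal Q"
          using Q(2) by (intro ennreal_mult) auto
        also have "ennreal (P\<^sup>2 * (2 * pi)) = ennreal (P\<^sup>2) * ennreal (2 * pi)"
          by (intro ennreal_mult) auto
        also have "ennreal (P\<^sup>2) = (ennreal P)\<^sup>2" using P(2) by (simp add: ennreal_power)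
        finally show ?thesis .
      qed
      then show ?thesis by (simp add: ac_simps)
    qed
    finally show "(\<integral>\<^sup>+\<xi>. ennreal (norm (fourier_integral (\<lambda>x. \<theta> x * u x) \<xi>)) \<partial>lborel)\<^sup>2
      \<le> ennreal K * (\<integral>\<^sup>+x. ennreal ((norm (u x))\<^sup>2) \<partial>lborel)"
      unfolding V_def .
  qed
qed

section \<open>From the distributional equation to bounds for eigenfunctions\<close>

lemma ident_lebesgue_measurable: "(\<lambda>x. x) \<in> lebesgue \<rightarrow>\<^sub>M (borel :: real measure)"
  by (rule measurable_completion) simp

lemma lebesgue_ex_borel_complex:
  fixes f :: "real \<Rightarrow> complex"
  assumes [measurable]: "f \<in> borel_measurable lebesgue"
  shows "\<exists>g\<in>borel_measurable borel. AE x in lebesgue. f x = g x"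
proof -
  have "(\<lambda>x. Re (f x)) \<in> borel_measurable lebesgue" "(\<lambda>x. Im (f x)) \<in> borel_measurable lebesgue"
    by measurable
  from this[THEN completion_ex_borel_measurable_real] obtain a b :: "real \<Rightarrow> real"
    where [measurable]: "a \<in> borel_measurable lborel" "b \<in> borel_measurable lborel"
      and ae: "AE x in lborel. Re (f x) = a x" "AE x in lborel. Im (f x) = b x" by blast
  have "(\<lambda>x. complex_of_real (a x) + \<i> * complex_of_real (b x)) \<in> borel_measurable borel" by measurable
  moreover from ae have "AE x in lborel. f x = complex_of_real (a x) + \<i> * complex_of_real (b x)"
    by eventually_elim (simp add: complex_eq_iff)
  ultimately show ?thesis by (intro bexI) (auto intro: AE_completion)
qed

lemma Lp_norm_2:
  "Lp_norm 2 M f = (let I = (\<integral>\<^sup>+x. ennreal ((norm (f x))\<^sup>2) \<partial>M) in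
     if I = \<infinity> then \<infinity> else ennreal (sqrt (enn2real I)))"
proof -
  have "(2::ennreal) \<noteq> \<infinity>" "enn2real 2 = 2" by auto
  then show ?thesis by (simp add: Lp_norm_def Let_def powr_half_sqrt)
qed

lemma Lp_norm_2_finite:
  assumes "Lp_norm 2 M f < \<infinity>"
  shows "(\<integral>\<^sup>+x. ennreal ((norm (f x))\<^sup>2) \<partial>M) < \<infinity>"
    and "(\<integral>\<^sup>+x. ennreal ((norm (f x))\<^sup>2) \<partial>M) = ennreal ((enn2real (Lp_norm 2 M f))\<^sup>2)"
proof -
  show fin: "(\<integral>\<^sup>+x. ennreal ((norm (f x))\<^sup>2) \<partial>M) < \<infinity>"
    using assms by (auto simp: Lp_norm_2 Let_def less_top split: if_splits)
  then show "(\<integral>\<^sup>+x. ennreal ((norm (f x))\<^sup>2) \<partial>M) = ennreal ((enn2real (Lp_norm 2 M f))\<^sup>2)"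
    by (auto simp: Lp_norm_2 Let_def)
qed

lemma Lp_norm_2_eq_0_AE:
  assumes [measurable]: "f \<in> borel_measurable M" and "Lp_norm 2 M f = 0"
  shows "AE x in M. f x = 0"
proof -
  have "(\<integral>\<^sup>+x. ennreal ((norm (f x))\<^sup>2) \<partial>M) = 0"
    using Lp_norm_2_finite(2)[of M f] assms(2) by simp
  then show ?thesis by (subst (asm) nn_integral_0_iff_AE) auto
qed

lemma Lp_norm_le_of_bounded:
  fixes f :: "real \<Rightarrow> complex"
  assumes S: "S \<in> sets lebesgue" and m: "emeasure lebesgue S \<le> ennreal m" "1 \<le> m"
    and f: "f \<in> borel_measurable lebesgue"
    and bound: "AE x in lebesgue. x \<in> S \<longrightarrow> norm (f x) \<le> M" and "0 \<le> M" and p: "1 \<le> p"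
  shows "Lp_norm p (lebesgue_on S) f \<le> ennreal (m * M)"
proof -
  have [measurable]: "f \<in> borel_measurable (lebesgue_on S)"
    using f by (rule measurable_restrict_space1)
  have ae: "AE x in lebesgue_on S. norm (f x) \<le> M"
    using bound S by (subst AE_restrict_space_iff) auto
  have M_le: "M \<le> m * M" using m(2) \<open>0 \<le> M\<close> by (simp add: mult_le_cancel_right1)
  show ?thesis
  proof (cases "p = \<infinity>")
    case True
    have "esssup (lebesgue_on S) (\<lambda>x. ennreal (norm (f x))) \<le> ennreal (m * M)"
      using ae M_le by (intro esssup_I) (auto elim!: eventually_mono intro!: ennreal_leI)
    then show ?thesis using True by (simp add: Lp_norm_def)
  next
    case False
    define q where "q = enn2real p"
    have "ennreal q = p" using False by (simp add: q_def less_top)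
    then have "ennreal 1 \<le> ennreal q" using p by simp
    then have q: "1 \<le> q" by (subst (asm) ennreal_le_iff) (auto simp: q_def)
    define I where "I = (\<integral>\<^sup>+x. ennreal (norm (f x) powr q) \<partial>lebesgue_on S)"
    have "I \<le> (\<integral>\<^sup>+x. ennreal (M powr q) \<partial>lebesgue_on S)"
      unfolding I_def
      by (rule nn_integral_mono_AE) (use ae q in \<open>auto elim!: eventually_mono intro!: ennreal_leI powr_mono2\<close>)
    also have "\<dots> = ennreal (M powr q) * emeasure lebesgue S"
      using S by (simp add: emeasure_restrict_space)
    also have "\<dots> \<le> ennreal (M powr q) * ennreal m" by (rule mult_left_mono[OF m(1)]) simp
    also have "\<dots> = ennreal (M powr q * m)" using m(2) by (simp add: ennreal_mult)
    finally have I: "I \<le> ennreal (M powr q * m)" .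
    then have "I \<noteq> \<infinity>" by (auto simp: top_unique)
    have "enn2real I \<le> M powr q * m" using enn2real_mono[OF I] m(2) by simp
    then have "enn2real I powr (1 / q) \<le> (M powr q * m) powr (1 / q)" using q by (intro powr_mono2) auto
    also have "\<dots> = M * m powr (1 / q)" using q m(2) \<open>0 \<le> M\<close> by (simp add: powr_mult powr_powr)
    also have "\<dots> \<le> M * m powr 1" using q m(2) \<open>0 \<le> M\<close> by (intro mult_left_mono powr_mono) auto
    finally have "enn2real I powr (1 / q) \<le> m * M"
      using m(2) by (simp add: mult.commute)
    then show ?thesis
      using False \<open>I \<noteq> \<infinity>\<close> by (simp add: Lp_norm_def Let_def flip: q_def I_def) (simp add: ennreal_leI)
  qed
qed

text \<open>
  For a function with bounded support the truncated Fourier integrals are eventually constant,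
  so their \<open>L\<^sup>2\<close> limit is the ordinary Fourier integral.
\<close>

lemma L2_fourier_compact_support:
  fixes u :: "real \<Rightarrow> complex"
  assumes F: "\<exists>U. has_L2_fourier e U" and [measurable]: "u \<in> borel_measurable borel"
    and eu: "AE x in lebesgue. e x = u x" and supp: "AE x in lebesgue. R < \<bar>x\<bar> \<longrightarrow> e x = 0"
  shows "AE \<xi> in lebesgue. L2_fourier e \<xi> = fourier_integral u \<xi>"
    and "L2_fourier e \<in> borel_measurable lebesgue"
proof -
  define U where "U = L2_fourier e"
  have U: "has_L2_fourier e U" unfolding U_def L2_fourier_def using F by (rule someI_ex)
  then have [measurable]: "U \<in> borel_measurable lebesgue" "e \<in> borel_measurable lebesgue"
    by (auto simp: has_L2_fourier_def L2_fun_def)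
  have [measurable]: "(\<lambda>x. fourier_integral u x) \<in> borel_measurable lebesgue" "u \<in> borel_measurable lebesgue"
    by (auto intro!: measurable_completion)
  note [measurable] = ident_lebesgue_measurable
  have "eventually (\<lambda>n. Lp_norm 2 lebesgue (\<lambda>\<xi>. fourier_integral (\<lambda>x. indicator {- real n..real n} x * e x) \<xi> - U \<xi>)
    = Lp_norm 2 lebesgue (\<lambda>\<xi>. fourier_integral u \<xi> - U \<xi>)) sequentially"
  proof -
    obtain N :: nat where N: "R \<le> real N" using real_arch_simple by blast
    have "fourier_integral (\<lambda>x. indicator {- real n..real n} x * e x) = fourier_integral u" if "N \<le> n" for n
    proof
      fix \<xi>
      show "fourier_integral (\<lambda>x. indicator {- real n..real n} x * e x) \<xi> = fourier_integral u \<xi>"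
        unfolding fourier_integral_def
      proof (rule integral_cong_AE)
        have "R \<le> real n" using N that by simp
        show "AE x in lebesgue. indicator {- real n..real n} x * e x * cis (- (x * \<xi>)) = u x * cis (- (x * \<xi>))"
          using eu supp
        proof eventually_elim
          case (elim x)
          show ?case
          proof (cases "x \<in> {- real n..real n}")
            case False
            then have "R < \<bar>x\<bar>" using \<open>R \<le> real n\<close> by auto
            with elim False show ?thesis by simp
          qed (use elim in simp)
        qed
      qed measurable
    qed
    then show ?thesis by (intro eventually_sequentiallyI[of N]) simp
  qed
  moreover have "(\<lambda>n. Lp_norm 2 lebesgue (\<lambda>\<xi>. fourier_integral (\<lambda>x. indicator {- real n..real n} x * e x) \<xi> - U \<xi>)) \<longlonglongrightarrow> 0"
    using U by (simp add: has_L2_fourier_def)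
  ultimately have "(\<lambda>n::nat. Lp_norm 2 lebesgue (\<lambda>\<xi>. fourier_integral u \<xi> - U \<xi>)) \<longlonglongrightarrow> 0"
    by (rule Lim_transform_eventually[rotated])
  then have "Lp_norm 2 lebesgue (\<lambda>\<xi>. fourier_integral u \<xi> - U \<xi>) = 0"
    by (simp add: LIMSEQ_const_iff)
  then have "AE \<xi> in lebesgue. fourier_integral u \<xi> - U \<xi> = 0"
    by (rule Lp_norm_2_eq_0_AE[rotated]) measurable
  then show "AE \<xi> in lebesgue. L2_fourier e \<xi> = fourier_integral u \<xi>"
    unfolding U_def by eventually_elim simp
  show "L2_fourier e \<in> borel_measurable lebesgue" unfolding U_def[symmetric] by measurable
qed

text \<open>
  Testing the equation with a cut-off modulated by the character of frequency \<open>\<xi>\<close> reads off the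
  Fourier transform at \<open>\<xi>\<close> of the localised equation. A Borel representative \<open>u\<close> replaces the
  Lebesgue measurable eigenfunction.
\<close>

lemma dirichlet_eigenfunction_fourier_equation:
  assumes e: "dirichlet_eigenfunction \<alpha> {-1<..<1} l e" and r: "0 < r" "r < 1"
    and [measurable]: "u \<in> borel_measurable borel" and eu: "AE x in lebesgue. e x = u x"
  shows "(LINT \<eta>|lborel. of_real (\<bar>\<eta>\<bar> powr \<alpha>) * fourier_integral u \<eta> * fourier_integral (bump r) (\<xi> - \<eta>)) / of_real (2 * pi)
      = of_real l * fourier_integral (\<lambda>x. bump r x * u x) \<xi>"
proof -
  define \<phi> where "\<phi> x = bump r x * cis ((- \<xi>) * x)" for x
  have [measurable]: "\<phi> \<in> borel_measurable borel" unfolding \<phi>_def by measurable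
  have meas: "(\<lambda>\<eta>. of_real (\<bar>\<eta>\<bar> powr \<alpha>) * fourier_integral u \<eta> * fourier_integral \<phi> (- \<eta>)) \<in> borel_measurable lborel"
    by measurable
  have F: "\<exists>U. has_L2_fourier e U" and supp: "AE x in lebesgue. 1 < \<bar>x\<bar> \<longrightarrow> e x = 0"
    and e_meas: "e \<in> borel_measurable lebesgue"
    using e unfolding dirichlet_eigenfunction_def sobolev_def has_L2_fourier_def L2_fun_def
    by (auto elim!: eventually_mono)
  have [measurable]: "e \<in> borel_measurable lebesgue" by (rule e_meas)
  note U = L2_fourier_compact_support[OF F \<open>u \<in> borel_measurable borel\<close> eu supp]
  have [measurable]: "L2_fourier e \<in> borel_measurable lebesgue" by (rule U(2))
  have [measurable]: "u \<in> borel_measurable lebesgue" "\<phi> \<in> borel_measurable lebesgue"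
     "(\<lambda>x. fourier_integral u x) \<in> borel_measurable lebesgue" "(\<lambda>x. fourier_integral \<phi> (- x)) \<in> borel_measurable lebesgue"
    by (auto intro!: measurable_completion)
  note [measurable] = ident_lebesgue_measurable
  have F\<phi>: "fourier_integral \<phi> (- \<eta>) = fourier_integral (bump r) (\<xi> - \<eta>)" for \<eta>
    unfolding fourier_integral_def \<phi>_def by (simp add: mult.assoc cis_mult algebra_simps)
  have "test_fun {-1<..<1} \<phi>" unfolding \<phi>_def by (rule test_fun_bump_cis[OF r])
  then have "frac_laplacian \<alpha> e \<phi> = of_real l * (LINT x|lebesgue. e x * \<phi> x)"
    using e unfolding dirichlet_eigenfunction_def by blast
  also have "(LINT x|lebesgue. e x * \<phi> x) = (LINT x|lebesgue. u x * \<phi> x)"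
    by (rule integral_cong_AE) (use eu in \<open>auto elim!: eventually_mono\<close>)
  also have "\<dots> = fourier_integral (\<lambda>x. bump r x * u x) \<xi>"
    unfolding fourier_integral_def \<phi>_def by (simp add: ac_simps)
  finally have "frac_laplacian \<alpha> e \<phi> = of_real l * fourier_integral (\<lambda>x. bump r x * u x) \<xi>" .
  moreover have "frac_laplacian \<alpha> e \<phi> = (LINT \<eta>|lebesgue. of_real (\<bar>\<eta>\<bar> powr \<alpha>) * fourier_integral u \<eta> * fourier_integral \<phi> (- \<eta>)) / of_real (2 * pi)"
    unfolding frac_laplacian_def fourier_multiplier_def
    by (rule arg_cong2[where f="(/)"], rule integral_cong_AE) (use U(1) in \<open>auto elim!: eventually_mono\<close>)
  moreover have "(LINT \<eta>|lebesgue. of_real (\<bar>\<eta>\<bar> powr \<alpha>) * fourier_integral u \<eta> * fourier_integral \<phi> (- \<eta>))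
     = (LINT \<eta>|lborel. of_real (\<bar>\<eta>\<bar> powr \<alpha>) * fourier_integral u \<eta> * fourier_integral \<phi> (- \<eta>))"
    by (rule integral_completion[OF meas])
  ultimately show ?thesis by (simp add: F\<phi>)
qed

text \<open>
  The bound is uniform in the eigenvalue. By Fourier inversion the cut-off eigenfunction is
  bounded by the \<open>L\<^sup>1\<close> norm of its Fourier transform, and the cut-off is bounded below on \<open>K\<close>.
\<close>

theorem dirichlet_eigenfunction_interior_bound:
  fixes \<alpha> :: real and K :: "real set"
  assumes \<alpha>: "0 < \<alpha>" "\<alpha> < 1" and K: "compact K" "K \<subseteq> {-1<..<1}"
  shows "\<exists>C>0. \<forall>l e. 0 < l \<longrightarrow> dirichlet_eigenfunction \<alpha> {-1<..<1} l e \<longrightarrow>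
    (AE x in lebesgue. x \<in> K \<longrightarrow> norm (e x) \<le> C * enn2real (Lp_norm 2 lebesgue e))"
proof -
  obtain s where s: "0 < s" "s < 1" "\<And>x. x \<in> K \<Longrightarrow> \<bar>x\<bar> \<le> s"
  proof (cases "K = {}")
    case False
    have "compact (abs ` K)" by (intro compact_continuous_image continuous_intros K)
    with False obtain y where y: "y \<in> K" "\<And>x. x \<in> K \<Longrightarrow> \<bar>x\<bar> \<le> \<bar>y\<bar>"
      using compact_attains_sup[of "abs ` K"] by auto
    have "\<bar>y\<bar> < 1" using subsetD[OF K(2) y(1)] by auto
    then show ?thesis
    proof (intro that[of "(\<bar>y\<bar> + 1) / 2"])
      show "\<bar>x\<bar> \<le> (\<bar>y\<bar> + 1) / 2" if "x \<in> K" for x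
        using y(2)[OF that] \<open>\<bar>y\<bar> < 1\<close> by simp
    qed auto
  qed (use that[of "1/2"] in auto)
  \<comment> \<open>Strict room on both sides: \<open>s < r\<close> bounds the cut-off below on \<open>K\<close>, \<open>r < 1\<close> makes it a test function.\<close>
  define r where "r = (s + 1) / 2"
  have r: "0 < r" "r < 1" "s < r" using s by (auto simp: r_def)
  define c where "c = (exp (- (1 / (r - s))))\<^sup>2"
  have "0 < c" by (simp add: c_def)
  obtain D where D: "\<And>\<xi>. (1 + \<bar>\<xi>\<bar>) * norm (fourier_integral (bump r) \<xi>) \<le> D * inverse (1 + \<xi>\<^sup>2)"
    using smooth_fourier_decay_quadratic[of "bump r" r] bump_algebra_smooth[OF bump_algebra_bump] bump_eq_0[of r]
    by (auto simp: less_imp_le)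
  obtain A where "0 \<le> A" and A: "\<And>\<mu> u. 0 < \<mu> \<Longrightarrow> integrable lborel u \<Longrightarrow>
    (\<forall>\<xi>. (LINT \<eta>|lborel. of_real (\<bar>\<eta>\<bar> powr \<alpha>) * fourier_integral u \<eta> * fourier_integral (bump r) (\<xi> - \<eta>)) / of_real (2 * pi)
       = of_real (\<mu> powr \<alpha>) * fourier_integral (\<lambda>x. bump r x * u x) \<xi>) \<Longrightarrow>
    (\<integral>\<^sup>+\<xi>. ennreal (norm (fourier_integral (\<lambda>x. bump r x * u x) \<xi>)) \<partial>lborel)\<^sup>2
      \<le> ennreal A * (\<integral>\<^sup>+x. ennreal ((norm (u x))\<^sup>2) \<partial>lborel)"
    using localized_eigenfunction_fourier_L1[OF \<alpha> integrable_bump D] by blast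
  \<comment> \<open>\<open>c\<close> is the lower bound of the cut-off on \<open>K\<close>; the summand 1 keeps the constant positive.\<close>
  show ?thesis
  proof (intro exI[of _ "(sqrt A + 1) / c"] conjI allI impI)
    show "0 < (sqrt A + 1) / c" using \<open>0 < c\<close> \<open>0 \<le> A\<close> by (simp add: add_nonneg_pos)
    fix l :: real and e
    assume l: "0 < l" and e: "dirichlet_eigenfunction \<alpha> {-1<..<1} l e"
    define n where "n = enn2real (Lp_norm 2 lebesgue e)"
    have "0 \<le> n" by (simp add: n_def)
    have L2: "L2_fun e" and supp: "AE x in lebesgue. x \<notin> {-1<..<1} \<longrightarrow> e x = 0"
      using e unfolding dirichlet_eigenfunction_def sobolev_def has_L2_fourier_def by auto
    have e_meas [measurable]: "e \<in> borel_measurable lebesgue" using L2 by (simp add: L2_fun_def)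
    obtain u where u [measurable]: "u \<in> borel_measurable borel" and eu: "AE x in lebesgue. e x = u x"
      using lebesgue_ex_borel_complex[OF e_meas] by blast
    have "(\<integral>\<^sup>+x. ennreal ((norm (u x))\<^sup>2) \<partial>lborel) = (\<integral>\<^sup>+x. ennreal ((norm (u x))\<^sup>2) \<partial>lebesgue)"
      by (simp add: nn_integral_completion)
    also have "\<dots> = (\<integral>\<^sup>+x. ennreal ((norm (e x))\<^sup>2) \<partial>lebesgue)"
      by (rule nn_integral_cong_AE) (use eu in \<open>auto elim!: eventually_mono\<close>)
    also have "\<dots> = ennreal (n\<^sup>2)"
      unfolding n_def using L2 by (intro Lp_norm_2_finite) (simp add: L2_fun_def)
    finally have N2: "(\<integral>\<^sup>+x. ennreal ((norm (u x))\<^sup>2) \<partial>lborel) = ennreal (n\<^sup>2)" .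
    have "AE x in lebesgue. x \<notin> {-1<..<1} \<longrightarrow> u x = 0"
      using supp eu by eventually_elim auto
    then have supp_u: "AE x in lborel. x \<notin> {-1<..<1} \<longrightarrow> u x = 0"
      by (simp add: AE_completion_iff)
    have iu: "integrable lborel u"
    proof (rule Bochner_Integration.integrable_bound)
      have "integrable lborel (\<lambda>x. (norm (u x))\<^sup>2)"
        by (rule integrableI_nonneg) (auto simp: N2)
      then show "integrable lborel (\<lambda>x. indicator {-1<..<1} x + (norm (u x))\<^sup>2)"
        by (intro Bochner_Integration.integrable_add integrable_indicator_Ioo)
      show "AE x in lborel. norm (u x) \<le> norm (indicator {-1<..<1} x + (norm (u x))\<^sup>2)"
        using supp_u
      proof eventually_elim
        case (elim x)
        have "t \<le> 1 + t\<^sup>2" for t :: real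
        proof -
          have "2 * t \<le> t\<^sup>2 + 1" using sum_squares_bound[of t 1] by simp
          with zero_le_power2[of t] show ?thesis by linarith
        qed
        from this[of "norm (u x)"] elim show ?case by (auto simp: indicator_def)
      qed
    qed simp
    define v where "v x = bump r x * u x" for x
    have [measurable]: "v \<in> borel_measurable borel" unfolding v_def by measurable
    have iv: "integrable lborel v"
      by (rule Bochner_Integration.integrable_bound[OF iu])
        (use norm_bump_le[of r] in \<open>auto simp: v_def norm_mult intro!: mult_left_le_one_le\<close>)
    \<comment> \<open>The frequency at which the symbol equals the eigenvalue.\<close>
    define \<mu> where "\<mu> = l powr (1 / \<alpha>)"
    have \<mu>: "0 < \<mu>" "\<mu> powr \<alpha> = l" using l \<alpha> by (auto simp: \<mu>_def powr_powr)
    define J where "J = (\<integral>\<^sup>+\<xi>. ennreal (norm (fourier_integral v \<xi>)) \<partial>lborel)"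
    have J2: "J\<^sup>2 \<le> ennreal (A * n\<^sup>2)"
    proof -
      have "J\<^sup>2 \<le> ennreal A * ennreal (n\<^sup>2)"
        unfolding J_def v_def N2[symmetric]
        by (rule A[OF \<mu>(1) iu]) (use dirichlet_eigenfunction_fourier_equation[OF e r(1,2) u eu] \<mu>(2) in auto)
      then show ?thesis using \<open>0 \<le> A\<close> by (simp add: ennreal_mult')
    qed
    have "J < \<infinity>"
      using order_le_less_trans[OF J2 ennreal_less_top] by (simp add: power_less_top_ennreal)
    then have iV: "integrable lborel (fourier_integral v)"
      by (intro integrableI_bounded) (auto simp: J_def)
    define j where "j = (LINT \<xi>|lborel. norm (fourier_integral v \<xi>))"
    have "0 \<le> j" by (simp add: j_def)
    have J: "J = ennreal j"
      unfolding J_def j_def using iV by (intro nn_integral_eq_integral) auto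
    have "j\<^sup>2 \<le> A * n\<^sup>2"
      using J2 \<open>0 \<le> j\<close> \<open>0 \<le> A\<close> unfolding J by (simp add: ennreal_power)
    then have "j \<le> sqrt (A * n\<^sup>2)" by (rule real_le_rsqrt)
    then have j: "j \<le> sqrt A * n" using \<open>0 \<le> n\<close> by (simp add: real_sqrt_mult)
    have "AE x in lborel. norm (v x) \<le> j"
      using fourier_inversion_AE[OF iv iV]
    proof eventually_elim
      case (elim x)
      have "norm (LINT \<xi>|lborel. fourier_integral v \<xi> * cis (x * \<xi>)) \<le> (LINT \<xi>|lborel. norm (fourier_integral v \<xi> * cis (x * \<xi>)))"
        by (rule integral_norm_bound)
      then have "norm (LINT \<xi>|lborel. fourier_integral v \<xi> * cis (x * \<xi>)) \<le> j" by (simp add: j_def norm_mult)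
      then have "norm (LINT \<xi>|lborel. fourier_integral v \<xi> * cis (x * \<xi>)) / (2 * pi) \<le> j / 1"
        using pi_ge_two \<open>0 \<le> j\<close> by (intro frac_le) auto
      then show ?case
        by (subst elim) (simp add: norm_divide norm_mult)
    qed
    then have "AE x in lebesgue. norm (v x) \<le> j" by (rule AE_completion)
    then have "AE x in lebesgue. x \<in> K \<longrightarrow> norm (e x) \<le> (sqrt A + 1) / c * n"
      using eu
    proof eventually_elim
      case (elim x)
      show ?case
      proof
        assume "x \<in> K"
        have "c * norm (u x) \<le> norm (bump r x) * norm (u x)"
          unfolding c_def by (intro mult_right_mono norm_bump_ge s(3) r \<open>x \<in> K\<close>) auto
        also have "\<dots> \<le> sqrt A * n" using elim j by (simp add: v_def norm_mult)
        also have "\<dots> \<le> (sqrt A + 1) * n" using \<open>0 \<le> n\<close> by (simp add: mult_right_mono)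
        finally show "norm (e x) \<le> (sqrt A + 1) / c * n"
          using elim \<open>0 < c\<close> by (simp add: field_simps)
      qed
    qed
    then show "AE x in lebesgue. x \<in> K \<longrightarrow> norm (e x) \<le> (sqrt A + 1) / c * enn2real (Lp_norm 2 lebesgue e)"
      unfolding n_def .
  qed
qed

theorem theorem9:
  fixes \<alpha> p1 :: real and \<Omega> K :: "real set" and p :: ennreal
  assumes "0 < \<alpha>" and "\<alpha> < 1 / 4"
    and "\<Omega> = {-1<..<1}"
    and "p1 = 2 * (1 - 2 * \<alpha>) / (1 - 4 * \<alpha>)"
    and "compact K" and "K \<subseteq> \<Omega>"
    and "2 \<le> p"
  shows "\<exists>C::real. C > 0 \<and>
    (\<forall>l::real. \<forall>e :: real \<Rightarrow> complex. l > 1 \<longrightarrow> dirichlet_eigenfunction \<alpha> \<Omega> l e \<longrightarrow>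
       (p \<le> ennreal p1 \<longrightarrow>
          Lp_norm p (lebesgue_on K) e \<le> ennreal C * Lp_norm 2 lebesgue e) \<and>
       (1 / 8 \<le> \<alpha> \<and> ennreal p1 < p \<longrightarrow>
          Lp_norm p (lebesgue_on K) e \<le>
            ennreal (C * l powr ((1 - 4 * \<alpha>) / (2 * \<alpha>) * (1 - enn2real (ennreal p1 / p))))
              * Lp_norm 2 lebesgue e) \<and>
       (\<alpha> < 1 / 8 \<and> ennreal p1 < p \<longrightarrow>
          Lp_norm p (lebesgue_on K) e \<le>
            ennreal (C * l powr ((1 - 2 * \<alpha>) / (3 * \<alpha>) * (1 - enn2real (ennreal p1 / p))))
              * Lp_norm 2 lebesgue e))"
proof -
  have K: "K \<subseteq> {-1<..<1}" using assms by simp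
  obtain C where "0 < C" and C: "\<And>l e. 0 < l \<Longrightarrow> dirichlet_eigenfunction \<alpha> {-1<..<1} l e \<Longrightarrow>
    (AE x in lebesgue. x \<in> K \<longrightarrow> norm (e x) \<le> C * enn2real (Lp_norm 2 lebesgue e))"
    using dirichlet_eigenfunction_interior_bound[OF \<open>0 < \<alpha>\<close> _ \<open>compact K\<close> K] assms(2) by auto
  \<comment> \<open>The factor 2 is the length of \<open>{-1<..<1}\<close>, which bounds its power \<open>1 / p\<close> for every \<open>p\<close>.\<close>
  have bound: "Lp_norm p (lebesgue_on K) e \<le> ennreal (2 * C) * Lp_norm 2 lebesgue e"
    if l: "1 < l" and e: "dirichlet_eigenfunction \<alpha> {-1<..<1} l e" for l e
  proof -
    have L2: "L2_fun e"
      using e unfolding dirichlet_eigenfunction_def sobolev_def has_L2_fourier_def by auto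
    have "Lp_norm p (lebesgue_on K) e \<le> ennreal (2 * (C * enn2real (Lp_norm 2 lebesgue e)))"
    proof (rule Lp_norm_le_of_bounded)
      show "K \<in> sets lebesgue" using \<open>compact K\<close> by (simp add: compact_imp_closed borel_closed)
      have "emeasure lebesgue K \<le> emeasure lebesgue {-1<..<1::real}" using K by (intro emeasure_mono) auto
      then show "emeasure lebesgue K \<le> ennreal 2" by simp
      show "e \<in> borel_measurable lebesgue" using L2 by (simp add: L2_fun_def)
      show "AE x in lebesgue. x \<in> K \<longrightarrow> norm (e x) \<le> C * enn2real (Lp_norm 2 lebesgue e)"
        using l by (intro C[OF _ e]) auto
      show "1 \<le> p" using \<open>2 \<le> p\<close> by (rule order_trans[rotated]) simp
    qed (use \<open>0 < C\<close> in auto)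
    also have "\<dots> = ennreal (2 * C) * ennreal (enn2real (Lp_norm 2 lebesgue e))"
      using \<open>0 < C\<close> by (simp add: ennreal_mult mult.assoc)
    also have "ennreal (enn2real (Lp_norm 2 lebesgue e)) = Lp_norm 2 lebesgue e"
      using L2 by (simp add: L2_fun_def)
    finally show ?thesis .
  qed
  have growth: "ennreal (2 * C) * N \<le> ennreal (2 * C * l powr (a * (1 - enn2real (ennreal p1 / p)))) * N"
    if "1 < l" "0 \<le> a" "ennreal p1 < p" for l a N
  proof -
    have "ennreal p1 / p \<le> 1"
      using that(3) by (cases "p = \<infinity>") (auto intro!: divide_le_posI_ennreal simp: less_imp_le zero_less_iff_neq_zero)
    then have "enn2real (ennreal p1 / p) \<le> 1" using enn2real_mono[of _ 1] by fastforce
    then have "1 \<le> l powr (a * (1 - enn2real (ennreal p1 / p)))"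
      using that by (intro ge_one_powr_ge_zero) auto
    then show ?thesis using \<open>0 < C\<close> by (intro mult_right_mono ennreal_leI) auto
  qed
  show ?thesis
  proof (intro exI[of _ "2 * C"] conjI allI impI)
    show "0 < 2 * C" using \<open>0 < C\<close> by simp
    fix l e assume l: "1 < l" and "dirichlet_eigenfunction \<alpha> \<Omega> l e"
    then have e: "dirichlet_eigenfunction \<alpha> {-1<..<1} l e" using assms by simp
    note b = bound[OF l e]
    show "Lp_norm p (lebesgue_on K) e \<le> ennreal (2 * C) * Lp_norm 2 lebesgue e" by (rule b)
    show "Lp_norm p (lebesgue_on K) e \<le>
            ennreal (2 * C * l powr ((1 - 4 * \<alpha>) / (2 * \<alpha>) * (1 - enn2real (ennreal p1 / p)))) * Lp_norm 2 lebesgue e"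
      if "1 / 8 \<le> \<alpha> \<and> ennreal p1 < p"
      by (rule order_trans[OF b growth]) (use that l assms in auto)
    show "Lp_norm p (lebesgue_on K) e \<le>
            ennreal (2 * C * l powr ((1 - 2 * \<alpha>) / (3 * \<alpha>) * (1 - enn2real (ennreal p1 / p)))) * Lp_norm 2 lebesgue e"
      if "\<alpha> < 1 / 8 \<and> ennreal p1 < p"
      by (rule order_trans[OF b growth]) (use that l assms in auto)
  qed
qed

end
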